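(* Let $(X,d,A)$ be a metric pair with $A\neq\emptyset$ and assume that the pair $(X,A)$ is boundedly compact. Let $T:\mathrm{Lip}_c(X,A)\to\mathbb{R}$ be a sequentially order continuous, bounded, positive linear functional. Then there is a unique $\mu\in\mathcal{M}_1^+(X,A)$ such that $T(f)=\int_X f\,d\mu$ for all $f\in\mathrm{Lip}_c(X,A)$.
   Context: A metric pair $(X,d,A)$ is a metric space $(X,d)$ with a closed subset $A\subset X$; $d_A(x)=\inf_{a\in A}d(x,a)$. The metric pair $(X,A)$ is boundedly compact if $X$ is locally compact and $\sigma$-compact and for each $x\in X\setminus A$ and all $\varepsilon,r>0$, the set $\overline{B}_r(x)\cap\overline{A_\varepsilon}$ is compact, where $A_\varepsilon=\{y\in X: d_A(y)>\varepsilon\}$. Measures take values in $[0,\infty]$. Let $\mathcal{B}^+(X)$ be the commutative monoid of Borel measures on $X$ and $\mathcal{B}^+(X,A)=\mathcal{B}^+(X)/\mathcal{B}^+(A)$ the quotient monoid: $\mu\sim\nu$ iff $\mu+\sigma=\nu+\tau$ for some Borel measures $\sigma,\tau$ concentrated on $A$; equivalently $\mu,\nu$ agree on Borel subsets of $X\setminus A$, so relative Borel measures correspond bijectively to Borel measures on $X\setminus A$. For $f$ vanishing on $A$, $\int_X f\,d\mu$ is well defined. $\mu$ is tight if $\mu(E)=\sup\{\mu(K): K\subset E \text{ compact}\}$ for every Borel $E\subset X\setminus A$. $\mathcal{M}_1^+(X,A)$ is the set of tight $\mu\in\mathcal{B}^+(X,A)$ with $\int d_A\,d\mu<\infty$.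 $\mathrm{Lip}_c(X,A)$ is the Riesz space (vector lattice) of compactly supported Lipschitz functions $f:X\to\mathbb{R}$ with $f|_A=0$, ordered pointwise and normed by the Lipschitz number $L(f)$ (least Lipschitz constant). A linear functional $T$ is bounded if $|T(f)|\le M\,L(f)$ for some $M$ and all $f$. In a Riesz space $E$, $x_n\xrightarrow{o}0$ means there is a decreasing sequence $(y_n)$ in $E$ with infimum $0$ in $E$ and $|x_n|\le y_n$; $T$ is sequentially order continuous if $x_n\xrightarrow{o}0$ implies $T(x_n)\to0$. *)

theory Defs
  imports "HOL-Analysis.Analysis"
begin

section \<open>Boundedly compact metric pairs\<close>

text \<open>
  The metric space \<open>X\<close> is the universe of a type of class \<open>metric_space\<close>, and \<open>d\<^sub>A(x)\<close> is
  \<open>infdist x A\<close>. The library sets \<open>infdist x {} = 0\<close>, so the definitions below that mention it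
  are only meaningful for nonempty \<open>A\<close>.
\<close>

definition metric_pair :: "'a::metric_space set \<Rightarrow> bool" where
  "metric_pair A \<longleftrightarrow> closed A"

definition boundedly_compact_pair :: "'a::metric_space set \<Rightarrow> bool" where
  "boundedly_compact_pair A \<longleftrightarrow>
     locally_compact_space (euclidean :: 'a topology) \<and>
     (\<exists>K :: nat \<Rightarrow> 'a set. (\<forall>n. compact (K n)) \<and> (\<Union>n. K n) = UNIV) \<and>
     (\<forall>x. x \<notin> A \<longrightarrow> (\<forall>\<epsilon>>0. \<forall>r>0. compact (cball x r \<inter> closure {y. infdist y A > \<epsilon>})))"

section \<open>Relative Borel measures\<close>

definition borel_measures :: "'a::topological_space measure set" where
  "borel_measures = {\<mu>. sets \<mu> = sets borel}"

definition add_borel :: "'a::topological_space measure \<Rightarrow> 'a measure \<Rightarrow> 'a measure" where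
  "add_borel \<mu> \<nu> = measure_of UNIV (sets borel) (\<lambda>E. emeasure \<mu> E + emeasure \<nu> E)"

text \<open>
  Measures on the closed set \<open>A\<close> are identified with the Borel measures on the whole space that
  vanish on the complement of \<open>A\<close>.
\<close>

definition borel_measures_on :: "'a::topological_space set \<Rightarrow> 'a measure set" where
  "borel_measures_on A = {\<sigma> \<in> borel_measures. emeasure \<sigma> (- A) = 0}"

definition rel_equiv :: "'a::topological_space set \<Rightarrow> ('a measure \<times> 'a measure) set" where
  "rel_equiv A = {(\<mu>, \<nu>). \<mu> \<in> borel_measures \<and> \<nu> \<in> borel_measures \<and>
     (\<exists>\<sigma>\<in>borel_measures_on A. \<exists>\<tau>\<in>borel_measures_on A. add_borel \<mu> \<sigma> = add_borel \<nu> \<tau>)}"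

text \<open>A relative Borel measure is an equivalence class, that is, a set of Borel measures.\<close>

definition rel_borel_measures :: "'a::topological_space set \<Rightarrow> 'a measure set set" where
  "rel_borel_measures A = borel_measures // rel_equiv A"

text \<open>
  The next three notions are required of every representative of a class. They do not depend on the
  representative if \<open>A\<close> is closed and the integrand is Borel and vanishes on \<open>A\<close>; see
  \<open>rel_equiv_iff\<close>, \<open>nn_integral_rel_equiv\<close> and \<open>has_bochner_integral_rel_equiv\<close> below.
\<close>

definition rel_tight :: "'a::topological_space set \<Rightarrow> 'a measure set \<Rightarrow> bool" where
  "rel_tight A m \<longleftrightarrow>
     (\<forall>\<mu>\<in>m. \<forall>E\<in>sets borel. E \<subseteq> - A \<longrightarrow>
        emeasure \<mu> E = (SUP K\<in>{K. compact K \<and> K \<subseteq> E}. emeasure \<mu> K))"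

definition has_rel_integral :: "'a::topological_space measure set \<Rightarrow> ('a \<Rightarrow> real) \<Rightarrow> real \<Rightarrow> bool" where
  "has_rel_integral m f I \<longleftrightarrow> (\<forall>\<mu>\<in>m. has_bochner_integral \<mu> f I)"

definition M1_plus :: "'a::metric_space set \<Rightarrow> 'a measure set set" where
  "M1_plus A = {m \<in> rel_borel_measures A. rel_tight A m \<and>
     (\<forall>\<mu>\<in>m. (\<integral>\<^sup>+x. ennreal (infdist x A) \<partial>\<mu>) < \<infinity>)}"

section \<open>Functionals on compactly supported Lipschitz functions\<close>

definition Lip_c :: "'a::metric_space set \<Rightarrow> ('a \<Rightarrow> real) set" where
  "Lip_c A = {f. (\<exists>C. C-lipschitz_on UNIV f) \<and> compact (closure {x. f x \<noteq> 0}) \<and> (\<forall>a\<in>A. f a = 0)}"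

definition Lip_number :: "('a::metric_space \<Rightarrow> real) \<Rightarrow> real" where
  "Lip_number f = Inf {C. C-lipschitz_on UNIV f}"

definition linear_functional_on :: "('a \<Rightarrow> real) set \<Rightarrow> (('a \<Rightarrow> real) \<Rightarrow> real) \<Rightarrow> bool" where
  "linear_functional_on E T \<longleftrightarrow>
     (\<forall>f\<in>E. \<forall>g\<in>E. T (\<lambda>x. f x + g x) = T f + T g) \<and>
     (\<forall>c. \<forall>f\<in>E. T (\<lambda>x. c * f x) = c * T f)"

definition positive_functional_on :: "('a \<Rightarrow> real) set \<Rightarrow> (('a \<Rightarrow> real) \<Rightarrow> real) \<Rightarrow> bool" where
  "positive_functional_on E T \<longleftrightarrow> (\<forall>f\<in>E. (\<lambda>_. 0) \<le> f \<longrightarrow> 0 \<le> T f)"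

definition Lip_bounded_functional_on ::
    "('a::metric_space \<Rightarrow> real) set \<Rightarrow> (('a \<Rightarrow> real) \<Rightarrow> real) \<Rightarrow> bool" where
  "Lip_bounded_functional_on E T \<longleftrightarrow> (\<exists>M. \<forall>f\<in>E. \<bar>T f\<bar> \<le> M * Lip_number f)"

text \<open>
  Order convergence to \<open>0\<close> in a Riesz space \<open>E\<close> of real functions, ordered pointwise. The infimum
  of the dominating sequence is taken inside \<open>E\<close> and need not be its pointwise infimum.
\<close>

definition order_null_seq :: "('a \<Rightarrow> real) set \<Rightarrow> (nat \<Rightarrow> 'a \<Rightarrow> real) \<Rightarrow> bool" where
  "order_null_seq E f \<longleftrightarrow> (\<forall>n. f n \<in> E) \<and>
     (\<exists>g. (\<forall>n. g n \<in> E) \<and> decseq g \<and>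
        (\<forall>n. (\<lambda>_. 0) \<le> g n) \<and> (\<forall>h\<in>E. (\<forall>n. h \<le> g n) \<longrightarrow> h \<le> (\<lambda>_. 0)) \<and>
        (\<forall>n. (\<lambda>x. \<bar>f n x\<bar>) \<le> g n))"

definition seq_order_continuous_on :: "('a \<Rightarrow> real) set \<Rightarrow> (('a \<Rightarrow> real) \<Rightarrow> real) \<Rightarrow> bool" where
  "seq_order_continuous_on E T \<longleftrightarrow>
     (\<forall>f. order_null_seq E f \<longrightarrow> (\<lambda>n. T (f n)) \<longlonglongrightarrow> 0)"

section \<open>Independence of representatives\<close>

lemma
  assumes "\<mu> \<in> borel_measures" "\<nu> \<in> borel_measures"
  shows sets_add_borel [simp]: "sets (add_borel \<mu> \<nu>) = sets borel"
    and space_add_borel [simp]: "space (add_borel \<mu> \<nu>) = UNIV"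
    and emeasure_add_borel: "E \<in> sets borel \<Longrightarrow> emeasure (add_borel \<mu> \<nu>) E = emeasure \<mu> E + emeasure \<nu> E"
proof -
  have sa: "sigma_algebra UNIV (sets (borel :: 'a measure))"
    using sets.sigma_algebra_axioms[of "borel :: 'a measure"] by simp
  then show "sets (add_borel \<mu> \<nu>) = sets borel"
    by (simp add: add_borel_def sigma_algebra.sigma_sets_eq)
  show "space (add_borel \<mu> \<nu>) = UNIV"
    by (simp add: add_borel_def space_measure_of_conv)
  have "countably_additive (sets borel) (\<lambda>E. emeasure \<mu> E + emeasure \<nu> E)"
  proof (rule countably_additiveI)
    fix B :: "nat \<Rightarrow> 'a set"
    assume B: "range B \<subseteq> sets borel" "disjoint_family B" "(\<Union>i. B i) \<in> sets borel"
    have "(\<Sum>i. emeasure \<mu> (B i)) = emeasure \<mu> (\<Union>i. B i)"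
         "(\<Sum>i. emeasure \<nu> (B i)) = emeasure \<nu> (\<Union>i. B i)"
      using B assms by (auto intro!: suminf_emeasure simp: borel_measures_def)
    then show "(\<Sum>i. emeasure \<mu> (B i) + emeasure \<nu> (B i)) =
        emeasure \<mu> (\<Union>i. B i) + emeasure \<nu> (\<Union>i. B i)"
      by (simp add: suminf_add[symmetric])
  qed
  then show "emeasure (add_borel \<mu> \<nu>) E = emeasure \<mu> E + emeasure \<nu> E" if "E \<in> sets borel"
    using that sa unfolding add_borel_def
    by (intro emeasure_measure_of_sigma) (auto simp: positive_def)
qed

lemma rel_equiv_iff:
  assumes A: "closed A" and \<mu>: "\<mu> \<in> borel_measures" and \<nu>: "\<nu> \<in> borel_measures"
  shows "(\<mu>, \<nu>) \<in> rel_equiv A \<longleftrightarrow> (\<forall>E\<in>sets borel. E \<subseteq> - A \<longrightarrow> emeasure \<mu> E = emeasure \<nu> E)"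
proof
  assume "(\<mu>, \<nu>) \<in> rel_equiv A"
  then obtain \<sigma> \<tau> where st: "\<sigma> \<in> borel_measures_on A" "\<tau> \<in> borel_measures_on A"
    and eq: "add_borel \<mu> \<sigma> = add_borel \<nu> \<tau>"
    by (auto simp: rel_equiv_def)
  show "\<forall>E\<in>sets borel. E \<subseteq> - A \<longrightarrow> emeasure \<mu> E = emeasure \<nu> E"
  proof (intro ballI impI)
    fix E :: "'a set" assume E: "E \<in> sets borel" "E \<subseteq> - A"
    have "emeasure \<rho> E = 0" if "\<rho> \<in> borel_measures_on A" for \<rho>
    proof -
      have "emeasure \<rho> E \<le> emeasure \<rho> (- A)"
        using that A E(2) by (intro emeasure_mono) (auto simp: borel_measures_on_def borel_measures_def)
      then show ?thesis using that by (simp add: borel_measures_on_def)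
    qed
    moreover have "emeasure (add_borel \<mu> \<sigma>) E = emeasure (add_borel \<nu> \<tau>) E" by (simp add: eq)
    ultimately show "emeasure \<mu> E = emeasure \<nu> E"
      using \<mu> \<nu> st E by (simp add: emeasure_add_borel borel_measures_on_def)
  qed
next
  assume *: "\<forall>E\<in>sets borel. E \<subseteq> - A \<longrightarrow> emeasure \<mu> E = emeasure \<nu> E"
  define r where "r \<rho> = density \<rho> (indicator A)" for \<rho> :: "'a measure"
  have r: "r \<rho> \<in> borel_measures_on A" "r \<rho> \<in> borel_measures"
    and er: "\<And>E. E \<in> sets borel \<Longrightarrow> emeasure (r \<rho>) E = emeasure \<rho> (A \<inter> E)"
    if "\<rho> \<in> borel_measures" for \<rho>
  proof -
    have s: "sets \<rho> = sets borel" using that by (simp add: borel_measures_def)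
    have "A \<in> sets \<rho>" using A s by simp
    then show er: "emeasure (r \<rho>) E = emeasure \<rho> (A \<inter> E)" if "E \<in> sets borel" for E
      using that s unfolding r_def
      by (subst emeasure_density) (auto simp: indicator_inter_arith[symmetric])
    show "r \<rho> \<in> borel_measures" using s by (simp add: r_def borel_measures_def)
    then show "r \<rho> \<in> borel_measures_on A" using er[of "- A"] A by (simp add: borel_measures_on_def)
  qed
  have split: "emeasure \<rho> E = emeasure \<rho> (A \<inter> E) + emeasure \<rho> (E - A)"
    if "\<rho> \<in> borel_measures" "E \<in> sets borel" for \<rho> E
  proof -
    have "emeasure \<rho> ((A \<inter> E) \<union> (E - A)) = emeasure \<rho> (A \<inter> E) + emeasure \<rho> (E - A)"
      using that A by (intro plus_emeasure[symmetric]) (auto simp: borel_measures_def)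
    moreover have "(A \<inter> E) \<union> (E - A) = E" by blast
    ultimately show ?thesis by simp
  qed
  have "add_borel \<mu> (r \<nu>) = add_borel \<nu> (r \<mu>)"
  proof (rule measure_eqI)
    show "sets (add_borel \<mu> (r \<nu>)) = sets (add_borel \<nu> (r \<mu>))" using r \<mu> \<nu> by simp
    fix E assume "E \<in> sets (add_borel \<mu> (r \<nu>))"
    then have E: "E \<in> sets borel" using r \<mu> \<nu> by simp
    have "E - A \<in> sets borel" using E A by auto
    then have "emeasure \<mu> (E - A) = emeasure \<nu> (E - A)" using * by auto
    then show "emeasure (add_borel \<mu> (r \<nu>)) E = emeasure (add_borel \<nu> (r \<mu>)) E"
      using split[OF \<mu> E] split[OF \<nu> E] r \<mu> \<nu> E by (simp add: emeasure_add_borel er ac_simps)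
  qed
  then show "(\<mu>, \<nu>) \<in> rel_equiv A" using \<mu> \<nu> r by (auto simp: rel_equiv_def)
qed

lemma equiv_rel_equiv: "closed A \<Longrightarrow> equiv borel_measures (rel_equiv A)"
proof (rule equivI)
  assume A: "closed A"
  show "rel_equiv A \<subseteq> borel_measures \<times> borel_measures" by (auto simp: rel_equiv_def)
  show "refl_on borel_measures (rel_equiv A)"
    using A by (auto simp: refl_on_def rel_equiv_iff)
  show "sym (rel_equiv A)" by (rule symI) (auto simp: rel_equiv_def, metis)
  show "trans (rel_equiv A)"
  proof (rule transI)
    fix \<mu> \<nu> \<rho> assume h: "(\<mu>, \<nu>) \<in> rel_equiv A" "(\<nu>, \<rho>) \<in> rel_equiv A"
    then have m: "\<mu> \<in> borel_measures" "\<nu> \<in> borel_measures" "\<rho> \<in> borel_measures"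
      by (auto simp: rel_equiv_def)
    then show "(\<mu>, \<rho>) \<in> rel_equiv A" using h A by (simp add: rel_equiv_iff)
  qed
qed

lemma density_rel_equiv:
  assumes A: "closed A" and h: "(\<mu>, \<nu>) \<in> rel_equiv A"
  shows "density \<mu> (indicator (- A)) = density \<nu> (indicator (- A))"
proof (rule measure_eqI)
  have m: "\<mu> \<in> borel_measures" "\<nu> \<in> borel_measures" using h by (auto simp: rel_equiv_def)
  then have s: "sets \<mu> = sets borel" "sets \<nu> = sets borel" by (auto simp: borel_measures_def)
  show "sets (density \<mu> (indicator (- A))) = sets (density \<nu> (indicator (- A)))" by (simp add: s)
  fix E assume "E \<in> sets (density \<mu> (indicator (- A)))"
  then have E: "E \<in> sets borel" by (simp add: s)
  have A': "- A \<in> sets borel" using A by auto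
  have "emeasure (density \<rho> (indicator (- A))) E = emeasure \<rho> (- A \<inter> E)"
    if "sets \<rho> = sets borel" for \<rho>
    using that E A' by (subst emeasure_density) (auto simp: indicator_inter_arith[symmetric])
  moreover have "emeasure \<mu> (- A \<inter> E) = emeasure \<nu> (- A \<inter> E)"
    using h E A' rel_equiv_iff[OF A m] by auto
  ultimately show "emeasure (density \<mu> (indicator (- A))) E = emeasure (density \<nu> (indicator (- A))) E"
    by (simp add: s)
qed

lemma nn_integral_rel_equiv:
  assumes A: "closed A" and h: "(\<mu>, \<nu>) \<in> rel_equiv A"
    and f: "f \<in> borel_measurable borel" "\<And>a. a \<in> A \<Longrightarrow> f a = 0"
  shows "(\<integral>\<^sup>+x. f x \<partial>\<mu>) = (\<integral>\<^sup>+x. f x \<partial>\<nu>)"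
proof -
  have "(\<integral>\<^sup>+x. f x \<partial>\<rho>) = (\<integral>\<^sup>+x. f x \<partial>density \<rho> (indicator (- A)))" if "\<rho> \<in> borel_measures" for \<rho>
  proof -
    have s: "sets \<rho> = sets borel" using that by (simp add: borel_measures_def)
    have "- A \<in> sets \<rho>" "f \<in> borel_measurable \<rho>"
      using A f(1) s by (auto simp: measurable_cong_sets[OF s refl])
    then have "(\<integral>\<^sup>+x. f x \<partial>density \<rho> (indicator (- A))) = (\<integral>\<^sup>+x. indicator (- A) x * f x \<partial>\<rho>)"
      by (intro nn_integral_density) auto
    also have "\<dots> = (\<integral>\<^sup>+x. f x \<partial>\<rho>)"
      by (intro nn_integral_cong) (auto simp: indicator_def f(2))
    finally show ?thesis by simp
  qed
  then show ?thesis using h density_rel_equiv[OF A h] by (auto simp: rel_equiv_def)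
qed

lemma has_bochner_integral_rel_equiv:
  fixes f :: "'a::topological_space \<Rightarrow> real"
  assumes A: "closed A" and h: "(\<mu>, \<nu>) \<in> rel_equiv A"
    and f: "f \<in> borel_measurable borel" "\<And>a. a \<in> A \<Longrightarrow> f a = 0"
  shows "has_bochner_integral \<mu> f I \<longleftrightarrow> has_bochner_integral \<nu> f I"
proof -
  have "has_bochner_integral \<rho> f I \<longleftrightarrow> has_bochner_integral (density \<rho> (indicator (- A))) f I"
    if "\<rho> \<in> borel_measures" for \<rho>
  proof -
    have s: "sets \<rho> = sets borel" using that by (simp add: borel_measures_def)
    have A': "- A \<in> sets \<rho>" and f': "f \<in> borel_measurable \<rho>"
      using A f(1) s by (auto simp: measurable_cong_sets[OF s refl])
    have d: "density \<rho> (indicator (- A)) = density \<rho> (\<lambda>x. ennreal (indicator (- A) x))"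
      by (intro arg_cong[where f = "density \<rho>"]) (auto simp: indicator_def)
    have e: "(\<lambda>x. indicator (- A) x *\<^sub>R f x) = f"
      by (rule ext) (auto simp: indicator_def f(2))
    have "integrable (density \<rho> (indicator (- A))) f = integrable \<rho> (\<lambda>x. indicator (- A) x *\<^sub>R f x)"
      unfolding d using A' f' by (intro integrable_density) auto
    moreover have "integral\<^sup>L (density \<rho> (indicator (- A))) f = integral\<^sup>L \<rho> (\<lambda>x. indicator (- A) x *\<^sub>R f x)"
      unfolding d using A' f' by (intro integral_density) auto
    ultimately show ?thesis unfolding has_bochner_integral_iff e by simp
  qed
  then show ?thesis using h density_rel_equiv[OF A h] by (auto simp: rel_equiv_def)
qed

end

theory Submission
  imports Defs
begin

text \<open>
  If \<open>f\<^sub>n\<close> increases pointwise to \<open>f\<close> in \<open>Lip_c A\<close>, then \<open>f - f\<^sub>n\<close> is an order null sequence, so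
  \<open>T f\<^sub>n\<close> tends to \<open>T f\<close>: \<open>T\<close> is a Daniell integral on a vector lattice closed under truncation by
  constants. Bounded compactness lets one cut off functions of \<open>d\<^sub>A\<close> to members of \<open>Lip_c A\<close>, so every
  open set off \<open>A\<close> has an indicator that is an increasing limit of such functions. Hence \<open>T\<close> prescribes
  the measure of open sets, Caratheodory's construction extends it to all Borel sets, and slicing \<open>f\<close>
  horizontally recovers \<open>T f\<close> as an integral. The moment bound comes from approximating \<open>d\<^sub>A\<close> from
  below by 1-Lipschitz functions, and tightness from outer regularity on the compact sets that exhaust
  \<open>- A\<close>.
\<close>

section \<open>Compactly supported Lipschitz functions\<close>

lemma Lip_cD:
  assumes "f \<in> Lip_c A"
  shows Lip_c_lipschitz: "\<exists>C\<ge>0. \<forall>x y. \<bar>f x - f y\<bar> \<le> C * dist x y"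
    and Lip_c_compact: "compact (closure {x. f x \<noteq> 0})"
    and Lip_c_zero: "a \<in> A \<Longrightarrow> f a = 0"
  using assms by (auto simp: Lip_c_def lipschitz_on_def dist_real_def)

lemma Lip_cI:
  assumes "\<And>x y. \<bar>f x - f y\<bar> \<le> C * dist x y" "0 \<le> C" "{x. f x \<noteq> 0} \<subseteq> K" "compact K"
    and "\<And>a. a \<in> A \<Longrightarrow> f a = 0"
  shows "f \<in> Lip_c A"
proof -
  have "closure {x. f x \<noteq> 0} \<subseteq> K"
    using assms(3,4) by (simp add: closure_minimal compact_imp_closed)
  then have "compact (closure {x. f x \<noteq> 0})"
    using assms(4) by (metis closed_closure compact_Int_closed inf.absorb_iff2)
  moreover have "C-lipschitz_on UNIV f"
    using assms(1,2) by (auto simp: lipschitz_on_def dist_real_def)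
  ultimately show ?thesis
    using assms(5) by (auto simp: Lip_c_def)
qed

lemma Lip_c_continuous: "f \<in> Lip_c A \<Longrightarrow> continuous_on UNIV f"
  by (auto simp: Lip_c_def intro: lipschitz_on_continuous_on)

lemma Lip_c_measurable: "f \<in> Lip_c A \<Longrightarrow> f \<in> borel_measurable borel"
  by (intro borel_measurable_continuous_onI Lip_c_continuous)

lemma Lip_c_le_bound:
  assumes "f \<in> Lip_c A"
  obtains B where "\<And>x. f x \<le> B"
proof -
  have "compact (f ` closure {x. f x \<noteq> 0})"
    using Lip_c_compact[OF assms] Lip_c_continuous[OF assms]
    by (intro compact_continuous_image) (auto intro: continuous_on_subset)
  then obtain b where b: "\<And>y. y \<in> f ` closure {x. f x \<noteq> 0} \<Longrightarrow> norm y \<le> b"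
    by (meson bounded_iff compact_imp_bounded)
  have "f x \<le> max 0 b" for x
    using b[of "f x"] closure_subset[of "{x. f x \<noteq> 0}"] by (cases "f x = 0") auto
  then show ?thesis using that by blast
qed

text \<open>A single criterion behind closure under sums, multiples and lattice operations: if
  Lipschitz constants \<open>C\<close>, \<open>D\<close> serve for \<open>f\<close>,
  \<open>g\<close>, then \<open>c * (C + D)\<close> serves for \<open>h\<close>, and
  \<open>h\<close> lives on the union of the two compact supports.\<close>

lemma Lip_c_dominated:
  assumes f: "f \<in> Lip_c A" and g: "g \<in> Lip_c A" and "0 \<le> c"
    and h: "\<And>x y. \<bar>h x - h y\<bar> \<le> c * (\<bar>f x - f y\<bar> + \<bar>g x - g y\<bar>)"
    and h0: "\<And>x. f x = 0 \<Longrightarrow> g x = 0 \<Longrightarrow> h x = 0"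
  shows "h \<in> Lip_c A"
proof -
  obtain C D where C: "0 \<le> C" "\<And>x y. \<bar>f x - f y\<bar> \<le> C * dist x y"
    and D: "0 \<le> D" "\<And>x y. \<bar>g x - g y\<bar> \<le> D * dist x y"
    using Lip_c_lipschitz[OF f] Lip_c_lipschitz[OF g] by blast
  show ?thesis
  proof (rule Lip_cI)
    fix x y
    have "c * (\<bar>f x - f y\<bar> + \<bar>g x - g y\<bar>) \<le> c * (C * dist x y + D * dist x y)"
      using C D \<open>0 \<le> c\<close> by (intro mult_left_mono add_mono) auto
    then show "\<bar>h x - h y\<bar> \<le> (c * (C + D)) * dist x y"
      using h[of x y] by (simp add: algebra_simps)
  next
    show "{x. h x \<noteq> 0} \<subseteq> closure {x. f x \<noteq> 0} \<union> closure {x. g x \<noteq> 0}"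
      using h0 closure_subset[of "{x. f x \<noteq> 0}"] closure_subset[of "{x. g x \<noteq> 0}"] by blast
  qed (use f g C D \<open>0 \<le> c\<close> h0 in \<open>auto simp: Lip_c_compact compact_Un Lip_c_zero\<close>)
qed

lemma Lip_c_0: "(\<lambda>x. 0) \<in> Lip_c A"
  by (rule Lip_cI[where C = 0 and K = "{}"]) auto

lemma Lip_c_add: "f \<in> Lip_c A \<Longrightarrow> g \<in> Lip_c A \<Longrightarrow> (\<lambda>x. f x + g x) \<in> Lip_c A"
  by (rule Lip_c_dominated[where f = f and g = g and c = 1]) auto

lemma Lip_c_diff: "f \<in> Lip_c A \<Longrightarrow> g \<in> Lip_c A \<Longrightarrow> (\<lambda>x. f x - g x) \<in> Lip_c A"
  by (rule Lip_c_dominated[where f = f and g = g and c = 1]) auto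

lemma Lip_c_cmult: "f \<in> Lip_c A \<Longrightarrow> (\<lambda>x. c * f x) \<in> Lip_c A"
  by (rule Lip_c_dominated[where f = f and g = f and c = "\<bar>c\<bar>"])
    (auto simp flip: right_diff_distrib simp: abs_mult)

lemma Lip_c_min: "f \<in> Lip_c A \<Longrightarrow> g \<in> Lip_c A \<Longrightarrow> (\<lambda>x. min (f x) (g x)) \<in> Lip_c A"
  by (rule Lip_c_dominated[where f = f and g = g and c = 1]) auto

lemma Lip_c_max: "f \<in> Lip_c A \<Longrightarrow> g \<in> Lip_c A \<Longrightarrow> (\<lambda>x. max (f x) (g x)) \<in> Lip_c A"
  by (rule Lip_c_dominated[where f = f and g = g and c = 1]) auto

lemma Lip_c_min_const: "f \<in> Lip_c A \<Longrightarrow> 0 \<le> c \<Longrightarrow> (\<lambda>x. min (f x) c) \<in> Lip_c A"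
  by (rule Lip_c_dominated[where f = f and g = f and c = 1]) (auto simp: min_def)

lemma Lip_c_sum: "finite I \<Longrightarrow> (\<And>i. i \<in> I \<Longrightarrow> f i \<in> Lip_c A) \<Longrightarrow> (\<lambda>x. \<Sum>i\<in>I. f i x) \<in> Lip_c A"
  by (induction I rule: finite_induct) (auto simp: Lip_c_0 Lip_c_add)

section \<open>Approximation of distance functions and indicators of open sets by members of
  \<open>Lip_c A\<close>\<close>

locale boundedly_compact =
  fixes A :: "'a::metric_space set"
  assumes closed_A: "closed A" and A_nonempty: "A \<noteq> {}"
    and bounded_compact: "x \<notin> A \<Longrightarrow> 0 < \<epsilon> \<Longrightarrow> 0 < r \<Longrightarrow> compact (cball x r \<inter> closure {y. infdist y A > \<epsilon>})"
begin

text \<open>The source of all test functions. With \<open>B = A\<close> it approximates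
  \<open>infdist x A\<close>, which gives the moment bound; with \<open>B\<close> the complement of
  an open set together with \<open>A\<close> it yields indicators. Bounded compactness enters
  through the supports, the uniform constant 1 through the boundedness of the functional.\<close>

lemma approx_infdist:
  assumes B: "closed B" "A \<subseteq> B"
  obtains \<psi> where "\<And>n. \<psi> n \<in> Lip_c A" "\<And>n x y. \<bar>\<psi> n x - \<psi> n y\<bar> \<le> dist x y"
    "\<And>n x. (0::real) \<le> \<psi> n x" "\<And>n x. \<psi> n x \<le> \<psi> (Suc n) x" "\<And>x. (\<lambda>n. \<psi> n x) \<longlonglongrightarrow> infdist x B"
proof (cases "A = UNIV")
  case True
  \<comment> \<open>No point off \<open>A\<close> is available as a centre, but the distance to
    \<open>B\<close> is identically 0.\<close>
  then have "B = UNIV" using B by auto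
  then show ?thesis using that[of "\<lambda>n x. 0"] by (simp add: Lip_c_0)
next
  case False
  then obtain p where p: "p \<notin> A" by auto
  \<comment> \<open>Subtracting \<open>1 / Suc n\<close> keeps the support away from
    \<open>B\<close>, hence from \<open>A\<close>; the term \<open>real n - dist x p\<close> keeps
    it in a ball. Both expressions are 1-Lipschitz and increase with \<open>n\<close>.\<close>
  define \<psi> where "\<psi> n x = max 0 (min (infdist x B - 1 / Suc n) (real n - dist x p))" for n x
  have lip: "\<bar>\<psi> n x - \<psi> n y\<bar> \<le> dist x y" for n x y
  proof -
    have "\<bar>max 0 (min a b) - max 0 (min a' b')\<bar> \<le> max \<bar>a - a'\<bar> \<bar>b - b'\<bar>" for a b a' b' :: real
      by (auto simp: max_def min_def)
    then have "\<bar>\<psi> n x - \<psi> n y\<bar> \<le> max \<bar>infdist x B - 1 / Suc n - (infdist y B - 1 / Suc n)\<bar>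
        \<bar>real n - dist x p - (real n - dist y p)\<bar>"
      unfolding \<psi>_def .
    also have "\<dots> \<le> dist x y"
      using infdist_triangle_abs[of x B y] abs_dist_diff_le[of x p y]
      by (simp add: dist_commute)
    finally show ?thesis .
  qed
  have zero: "\<psi> n b = 0" if "b \<in> B" for n b
    using that unfolding \<psi>_def by (intro max.absorb1 min.coboundedI1) (simp add: infdist_zero)
  have dist_le: "infdist x B \<le> infdist x A" for x
    using B A_nonempty by (simp add: infdist_mono)
  have mem: "\<psi> n \<in> Lip_c A" for n
  proof (rule Lip_cI[where C = 1])
    \<comment> \<open>The radius is \<open>Suc n\<close> rather than \<open>n\<close> so that it is
      positive for \<open>n = 0\<close> too.\<close>
    show "compact (cball p (real (Suc n)) \<inter> closure {y. infdist y A > 1 / Suc n / 2})"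
      using p by (intro bounded_compact) auto
    have "x \<in> cball p (real (Suc n)) \<inter> {y. infdist y A > 1 / Suc n / 2}" if "\<psi> n x \<noteq> 0" for x
    proof -
      have "0 < min (infdist x B - 1 / Suc n) (real n - dist x p)"
        using that unfolding \<psi>_def by (auto simp: max_def split: if_splits)
      moreover have "1 / Suc n / 2 < 1 / real (Suc n)" by (simp add: field_simps)
      ultimately show ?thesis using dist_le[of x] by (auto simp: dist_commute)
    qed
    then show "{x. \<psi> n x \<noteq> 0} \<subseteq> cball p (real (Suc n)) \<inter> closure {y. infdist y A > 1 / Suc n / 2}"
      using closure_subset by blast
  qed (use lip zero B in auto)
  have mono: "\<psi> n x \<le> \<psi> (Suc n) x" for n x
  proof -
    have "1 / real (Suc (Suc n)) \<le> 1 / real (Suc n)"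
      by (intro divide_left_mono) auto
    then show ?thesis unfolding \<psi>_def by (intro max.mono min.mono) auto
  qed
  have lim: "(\<lambda>n. \<psi> n x) \<longlonglongrightarrow> infdist x B" for x
  proof -
    have "(\<lambda>n. max 0 (infdist x B - 1 / Suc n)) \<longlonglongrightarrow> max 0 (infdist x B - 0)"
      by (intro tendsto_intros LIMSEQ_Suc[OF lim_1_over_n])
    \<comment> \<open>Once \<open>n\<close> is at least \<open>infdist x B + dist x p\<close>, the
      ball term in the minimum is the larger one and drops out.\<close>
    moreover have "\<forall>\<^sub>F n in sequentially. max 0 (infdist x B - 1 / Suc n) = \<psi> n x"
      using eventually_ge_at_top[of "nat \<lceil>infdist x B + dist x p\<rceil>"]
    proof eventually_elim
      case (elim n)
      then have "infdist x B + dist x p \<le> real n" by linarith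
      moreover have "0 \<le> 1 / real (Suc n)" by simp
      ultimately have "infdist x B - 1 / Suc n \<le> real n - dist x p" by linarith
      then show ?case by (simp add: \<psi>_def)
    qed
    ultimately show ?thesis by (simp add: tendsto_cong infdist_nonneg)
  qed
  show ?thesis using that[of \<psi>] mem lip mono lim by (simp add: \<psi>_def)
qed

text \<open>The distance to \<open>- U \<union> A\<close> is positive exactly on
  \<open>U - A\<close>. Multiplying its approximants by \<open>n\<close> drives them to infinity
  there, and truncation at 1 turns this into the indicator.\<close>

lemma approx_open:
  assumes "open U"
  obtains u where "\<And>n. u n \<in> Lip_c A" "\<And>n x. (0::real) \<le> u n x" "\<And>n x. u n x \<le> indicator U x"
    "\<And>n x. u n x \<le> u (Suc n) x" "\<And>x. (\<lambda>n. u n x) \<longlonglongrightarrow> indicator (U - A) x"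
proof -
  have B: "closed (- U \<union> A)" "A \<subseteq> - U \<union> A" using assms closed_A by auto
  obtain \<psi> where \<psi>: "\<And>n. \<psi> n \<in> Lip_c A" "\<And>n x y. \<bar>\<psi> n x - \<psi> n y\<bar> \<le> dist x y"
    "\<And>n x. (0::real) \<le> \<psi> n x" "\<And>n x. \<psi> n x \<le> \<psi> (Suc n) x"
    "\<And>x. (\<lambda>n. \<psi> n x) \<longlonglongrightarrow> infdist x (- U \<union> A)"
    using approx_infdist[OF B] by metis
  define u where "u n x = min (real n * \<psi> n x) 1" for n x
  have inc: "incseq (\<lambda>n. \<psi> n x)" for x using \<psi>(4) by (intro incseq_SucI)
  \<comment> \<open>A nonnegative sequence increasing to 0 is constantly 0.\<close>
  have \<psi>0: "\<psi> n x = 0" if "x \<in> - U \<union> A" for n x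
    using incseq_le[OF inc \<psi>(5), of n x] \<psi>(3)[of n x] that by (simp add: infdist_zero)
  show ?thesis
  proof (rule that[of u])
    show "u n \<in> Lip_c A" for n unfolding u_def by (intro Lip_c_min_const Lip_c_cmult \<psi>) simp
    show "0 \<le> u n x" for n x using \<psi>(3) by (simp add: u_def)
    show "u n x \<le> indicator U x" for n x
      using \<psi>0[of x n] by (cases "x \<in> U") (auto simp: u_def)
    show "u n x \<le> u (Suc n) x" for n x
      using mult_mono[of "real n" "real (Suc n)" "\<psi> n x" "\<psi> (Suc n) x"] \<psi>(3,4)
      by (auto simp: u_def)
    show "(\<lambda>n. u n x) \<longlonglongrightarrow> indicator (U - A) x" for x
    proof (cases "x \<in> U - A")
      case True
      then have "0 < infdist x (- U \<union> A)"
        using B A_nonempty by (intro infdist_pos_not_in_closed) auto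
      then have "LIM n sequentially. \<psi> n x * real n :> at_top"
        by (intro filterlim_tendsto_pos_mult_at_top[OF \<psi>(5)] filterlim_real_sequentially)
      then have "\<forall>\<^sub>F n in sequentially. 1 \<le> \<psi> n x * real n"
        by (simp add: filterlim_at_top)
      then have "\<forall>\<^sub>F n in sequentially. u n x = indicator (U - A) x"
        by eventually_elim (use True in \<open>auto simp: u_def mult.commute\<close>)
      then show ?thesis by (rule tendsto_eventually)
    next
      case False
      then have "u n x = 0" for n using \<psi>0[of x n] by (auto simp: u_def)
      then show ?thesis using False by simp
    qed
  qed
qed

end

section \<open>Positive sequentially order continuous functionals\<close>

locale daniell_functional = boundedly_compact A for A :: "'a::metric_space set" +
  fixes T :: "('a \<Rightarrow> real) \<Rightarrow> real"
  assumes linear: "linear_functional_on (Lip_c A) T"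
    and positive: "positive_functional_on (Lip_c A) T"
    and order_continuous: "seq_order_continuous_on (Lip_c A) T"
begin

lemma T_add: "f \<in> Lip_c A \<Longrightarrow> g \<in> Lip_c A \<Longrightarrow> T (\<lambda>x. f x + g x) = T f + T g"
  using linear by (auto simp: linear_functional_on_def)

lemma T_cmult: "f \<in> Lip_c A \<Longrightarrow> T (\<lambda>x. c * f x) = c * T f"
  using linear by (auto simp: linear_functional_on_def)

lemma T_0: "T (\<lambda>x. 0) = 0"
  using T_cmult[OF Lip_c_0, of 0] by simp

lemma T_diff:
  assumes "f \<in> Lip_c A" "g \<in> Lip_c A"
  shows "T (\<lambda>x. f x - g x) = T f - T g"
  using T_add[OF Lip_c_diff[OF assms] assms(2)] by simp

lemma T_sum:
  "finite I \<Longrightarrow> (\<And>i. i \<in> I \<Longrightarrow> f i \<in> Lip_c A) \<Longrightarrow> T (\<lambda>x. \<Sum>i\<in>I. f i x) = (\<Sum>i\<in>I. T (f i))"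
  by (induction I rule: finite_induct) (auto simp: T_0 T_add Lip_c_sum)

lemma T_nonneg: "f \<in> Lip_c A \<Longrightarrow> (\<And>x. 0 \<le> f x) \<Longrightarrow> 0 \<le> T f"
  using positive by (auto simp: positive_functional_on_def le_fun_def)

lemma T_mono: "f \<in> Lip_c A \<Longrightarrow> g \<in> Lip_c A \<Longrightarrow> (\<And>x. f x \<le> g x) \<Longrightarrow> T f \<le> T g"
  using T_nonneg[of "\<lambda>x. g x - f x"] by (simp add: T_diff Lip_c_diff)

lemma T_monotone_convergence:
  assumes mem: "\<And>n. f n \<in> Lip_c A" "g \<in> Lip_c A"
    and inc: "\<And>n x. f n x \<le> f (Suc n) x" and lim: "\<And>x. (\<lambda>n. f n x) \<longlonglongrightarrow> g x"
  shows "(\<lambda>n. T (f n)) \<longlonglongrightarrow> T g"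
proof -
  define d where "d n x = g x - f n x" for n x
  have d: "d n \<in> Lip_c A" for n unfolding d_def by (intro Lip_c_diff mem)
  have dec: "decseq d"
    using inc by (intro decseq_SucI le_funI) (simp add: d_def)
  have d_lim: "(\<lambda>n. d n x) \<longlonglongrightarrow> 0" for x
    using tendsto_diff[OF tendsto_const lim, of "g x" x] by (simp add: d_def)
  have d_nonneg: "0 \<le> d n x" for n x
    by (rule decseq_ge[OF decseq_SucI d_lim]) (use inc in \<open>simp add: d_def\<close>)
  \<comment> \<open>A lower bound of the sequence lies below its pointwise limit 0, so the infimum
    within \<open>Lip_c A\<close> is 0 as well.\<close>
  have "h \<le> (\<lambda>x. 0)" if "\<forall>n. h \<le> d n" for h
  proof (rule le_funI)
    show "h x \<le> 0" for x
      by (rule LIMSEQ_le_const[OF d_lim]) (use that in \<open>auto simp: le_fun_def\<close>)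
  qed
  then have "order_null_seq (Lip_c A) d"
    unfolding order_null_seq_def using d dec d_nonneg
    by (intro conjI allI exI[of _ d]) (auto simp: le_fun_def)
  then have "(\<lambda>n. T (d n)) \<longlonglongrightarrow> 0"
    using order_continuous by (simp add: seq_order_continuous_on_def)
  moreover have "T (d n) = T g - T (f n)" for n
    unfolding d_def using mem by (intro T_diff)
  ultimately have "(\<lambda>n. T g - (T g - T (f n))) \<longlonglongrightarrow> T g - 0"
    by (intro tendsto_intros) simp
  then show ?thesis by simp
qed

section \<open>Outer measure of a Daniell functional\<close>

text \<open>The Riesz formula for the measure of an open set. As \<open>T\<close> is nonnegative on
  the admissible functions, \<open>ennreal\<close> truncates nothing.\<close>

definition open_mass :: "'a set \<Rightarrow> ennreal" where
  "open_mass U = (SUP f\<in>{f \<in> Lip_c A. \<forall>x. 0 \<le> f x \<and> f x \<le> indicator U x}. ennreal (T f))"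

lemma open_mass_upper:
  "f \<in> Lip_c A \<Longrightarrow> (\<And>x. 0 \<le> f x) \<Longrightarrow> (\<And>x. f x \<le> indicator U x) \<Longrightarrow> ennreal (T f) \<le> open_mass U"
  unfolding open_mass_def by (rule SUP_upper) auto

lemma open_mass_least:
  assumes "\<And>f. f \<in> Lip_c A \<Longrightarrow> (\<And>x. 0 \<le> f x) \<Longrightarrow> (\<And>x. f x \<le> indicator U x) \<Longrightarrow> ennreal (T f) \<le> b"
  shows "open_mass U \<le> b"
  unfolding open_mass_def using assms by (intro SUP_least) auto

text \<open>The addend may be infinite, so it is moved into the supremum instead of being
  subtracted; this is sound because the family contains 0.\<close>

lemma open_mass_add_le:
  assumes "\<And>f. f \<in> Lip_c A \<Longrightarrow> (\<And>x. 0 \<le> f x) \<Longrightarrow> (\<And>x. f x \<le> indicator U x) \<Longrightarrow> ennreal (T f) + c \<le> b"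
  shows "open_mass U + c \<le> b"
proof -
  let ?F = "{f \<in> Lip_c A. \<forall>x. 0 \<le> f x \<and> f x \<le> indicator U x}"
  have "(\<lambda>x. 0) \<in> ?F" by (simp add: Lip_c_0)
  then have "open_mass U + c = (SUP f\<in>?F. ennreal (T f) + c)"
    unfolding open_mass_def by (intro ennreal_SUP_add_left[symmetric]) auto
  also have "\<dots> \<le> b" using assms by (intro SUP_least) auto
  finally show ?thesis .
qed

text \<open>Admissible functions vanish on \<open>A\<close>, so only the part of \<open>U\<close>
  off \<open>A\<close> matters.\<close>

lemma open_mass_mono:
  assumes "U - A \<subseteq> V"
  shows "open_mass U \<le> open_mass V"
proof (rule open_mass_least)
  fix f assume f: "f \<in> Lip_c A" "\<And>x. 0 \<le> f x" "\<And>x. f x \<le> indicator U x"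
  have "f x \<le> indicator V x" for x
    using assms f(3)[of x] Lip_c_zero[OF f(1), of x]
    by (cases "x \<in> A"; cases "x \<in> U"; cases "x \<in> V") auto
  then show "ennreal (T f) \<le> open_mass V" by (intro open_mass_upper f)
qed

text \<open>Monotone convergence takes the place of a finite subcover: a function admissible for the
  union is the increasing limit of its minima with finite sums of functions admissible for the
  single \<open>U i\<close>.\<close>

lemma open_mass_UN:
  assumes U: "\<And>i::nat. open (U i)"
  shows "open_mass (\<Union>i. U i) \<le> (\<Sum>i. open_mass (U i))"
proof (rule open_mass_least)
  fix f assume f: "f \<in> Lip_c A" "\<And>x. 0 \<le> f x" "\<And>x. f x \<le> indicator (\<Union>i. U i) x"
  have "\<forall>i. \<exists>u. (\<forall>n. u n \<in> Lip_c A) \<and> (\<forall>n x. 0 \<le> u n x) \<and> (\<forall>n x. u n x \<le> indicator (U i) x)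
    \<and> (\<forall>n x. u n x \<le> u (Suc n) x) \<and> (\<forall>x. (\<lambda>n. u n x) \<longlonglongrightarrow> indicator (U i - A) x)"
    using approx_open[OF U] by metis
  then obtain u where u: "\<And>i n. u i n \<in> Lip_c A" "\<And>i n x. 0 \<le> u i n x"
    "\<And>i n x. u i n x \<le> indicator (U i) x" "\<And>i n x. u i n x \<le> u i (Suc n) x"
    "\<And>i x. (\<lambda>n. u i n x) \<longlonglongrightarrow> (indicator (U i - A) x :: real)"
    by metis
  \<comment> \<open>A diagonal sum: each stage adds one more set and improves the approximants of
    all earlier ones, so \<open>h\<close> increases.\<close>
  define h where "h n x = (\<Sum>i<n. u i n x)" for n x
  have h: "h n \<in> Lip_c A" for n unfolding h_def by (intro Lip_c_sum u) auto
  have h_inc: "h n x \<le> h (Suc n) x" for n x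
  proof -
    have "h n x \<le> (\<Sum>i<n. u i (Suc n) x)" unfolding h_def by (intro sum_mono u)
    also have "\<dots> \<le> h (Suc n) x" unfolding h_def using u(2) by simp
    finally show ?thesis .
  qed
  have lim: "(\<lambda>n. min (f x) (h n x)) \<longlonglongrightarrow> f x" for x
  proof (cases "x \<in> (\<Union>i. U i) - A")
    case False
    then have "f x = 0" using f(2,3)[of x] Lip_c_zero[OF f(1), of x] by (auto simp: indicator_def split: if_splits)
    moreover have "0 \<le> h n x" for n unfolding h_def by (intro sum_nonneg u)
    ultimately show ?thesis by simp
  next
    case True
    then obtain i where i: "x \<in> U i - A" by auto
    \<comment> \<open>Since \<open>f x \<le> 1\<close>, one summand tending to 1 already recovers
      \<open>f x\<close> in the minimum.\<close>
    have "f x \<le> 1" using f(3)[of x] by (rule order_trans) (simp add: indicator_def)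
    show ?thesis
    proof (rule tendsto_sandwich)
      show "(\<lambda>n. min (f x) (u i n x)) \<longlonglongrightarrow> f x"
        using tendsto_min[OF tendsto_const u(5), of "f x" i x] i \<open>f x \<le> 1\<close>
        by (auto simp: min_absorb1)
      show "\<forall>\<^sub>F n in sequentially. min (f x) (u i n x) \<le> min (f x) (h n x)"
        using eventually_gt_at_top[of i]
      proof eventually_elim
        case (elim n)
        then have "u i n x \<le> h n x"
          unfolding h_def using u(2) by (intro member_le_sum) auto
        then show ?case by simp
      qed
    qed auto
  qed
  have "(\<lambda>n. T (\<lambda>x. min (f x) (h n x))) \<longlonglongrightarrow> T f"
    using h_inc lim by (intro T_monotone_convergence Lip_c_min f h) (auto simp: min.coboundedI2)
  then have "(\<lambda>n. ennreal (T (\<lambda>x. min (f x) (h n x)))) \<longlonglongrightarrow> ennreal (T f)"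
    by (rule tendsto_ennrealI)
  moreover have "ennreal (T (\<lambda>x. min (f x) (h n x))) \<le> (\<Sum>i. open_mass (U i))" for n
  proof -
    have "ennreal (T (\<lambda>x. min (f x) (h n x))) \<le> ennreal (T (h n))"
      by (intro ennreal_leI T_mono Lip_c_min f h) auto
    also have "T (h n) = (\<Sum>i<n. T (u i n))"
      unfolding h_def by (intro T_sum u) auto
    also have "ennreal \<dots> = (\<Sum>i<n. ennreal (T (u i n)))"
      by (intro sum_ennreal[symmetric] T_nonneg u)
    also have "\<dots> \<le> (\<Sum>i<n. open_mass (U i))"
      by (intro sum_mono open_mass_upper u)
    also have "\<dots> \<le> (\<Sum>i. open_mass (U i))" by (intro sum_le_suminf) auto
    finally show ?thesis .
  qed
  ultimately show "ennreal (T f) \<le> (\<Sum>i. open_mass (U i))"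
    by (intro LIMSEQ_le_const2) auto
qed

text \<open>Only the part of \<open>E\<close> off \<open>A\<close> counts, so the resulting measure is the representative vanishing on \<open>A\<close>.\<close>

definition outer :: "'a set \<Rightarrow> ennreal" where
  "outer E = (INF U\<in>{U. open U \<and> E - A \<subseteq> U}. open_mass U)"

lemma outer_lower: "open U \<Longrightarrow> E - A \<subseteq> U \<Longrightarrow> outer E \<le> open_mass U"
  unfolding outer_def by (rule INF_lower) auto

lemma outer_greatest: "(\<And>U. open U \<Longrightarrow> E - A \<subseteq> U \<Longrightarrow> b \<le> open_mass U) \<Longrightarrow> b \<le> outer E"
  unfolding outer_def by (rule INF_greatest) auto

lemma outer_open: "open U \<Longrightarrow> outer U = open_mass U"
  by (intro antisym outer_lower outer_greatest open_mass_mono) auto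

lemma outer_mono: "E - A \<subseteq> F \<Longrightarrow> outer E \<le> outer F"
  by (intro outer_greatest outer_lower) auto

lemma outer_A: "outer A = 0"
proof -
  have "open_mass {} \<le> 0"
  proof (rule open_mass_least)
    fix f assume "f \<in> Lip_c A" and f: "\<And>x. 0 \<le> f x" "\<And>x. f x \<le> indicator {} x"
    then have "f = (\<lambda>x. 0)" by (intro ext antisym) auto
    then show "ennreal (T f) \<le> 0" using T_0 by simp
  qed
  then show ?thesis using outer_lower[of "{}" A] by simp
qed

lemma outer_UN: "outer (\<Union>i::nat. E i) \<le> (\<Sum>i. outer (E i))"
proof (rule ennreal_le_epsilon)
  fix e :: real assume e: "0 < e" and fin: "(\<Sum>i. outer (E i)) < top"
  have "\<exists>U. open U \<and> E i - A \<subseteq> U \<and> open_mass U \<le> outer (E i) + ennreal (e * (1/2) ^ Suc i)" for i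
  proof -
    have "outer (E i) \<noteq> top" using ennreal_suminf_lessD[OF fin, of i] by simp
    then have "outer (E i) < outer (E i) + ennreal (e * (1/2) ^ Suc i)" using e by (simp add: less_top)
    then show ?thesis
      unfolding outer_def INF_less_iff by (auto intro: less_imp_le)
  qed
  then obtain U where U: "\<And>i. open (U i)" "\<And>i. E i - A \<subseteq> U i"
    and c: "\<And>i. open_mass (U i) \<le> outer (E i) + ennreal (e * (1/2) ^ Suc i)"
    by metis
  have "outer (\<Union>i. E i) \<le> open_mass (\<Union>i. U i)" using U by (intro outer_lower) auto
  also have "\<dots> \<le> (\<Sum>i. open_mass (U i))" by (intro open_mass_UN U)
  also have "\<dots> \<le> (\<Sum>i. outer (E i) + ennreal (e * (1/2) ^ Suc i))"
    by (intro suminf_le c) auto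
  also have "\<dots> = (\<Sum>i. outer (E i)) + (\<Sum>i. ennreal (e * (1/2) ^ Suc i))"
    by (intro suminf_add[symmetric]) auto
  also have "(\<Sum>i. ennreal (e * (1/2) ^ Suc i)) = ennreal e"
    using sums_mult[OF power_half_series, of e] e by (intro suminf_ennreal_eq) auto
  finally show "outer (\<Union>i. E i) \<le> (\<Sum>i. outer (E i)) + ennreal e" .
qed

lemma outer_measure_space_outer: "outer_measure_space UNIV outer"
  unfolding outer_measure_space_def positive_def increasing_def countably_subadditive_def
  using outer_mono[of "{}" A] outer_A outer_UN by (auto intro!: outer_mono)

lemma outer_Un: "outer (E \<union> F) \<le> outer E + outer F"
proof -
  interpret sigma_algebra UNIV "UNIV :: 'a set set"
    using sigma_algebra_Pow[of "UNIV :: 'a set"] by simp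
  \<comment> \<open>The pair is made disjoint because \<open>subadditive\<close> speaks of disjoint
    sets.\<close>
  have "outer (E \<union> (F - E)) \<le> outer E + outer (F - E)"
    using outer_measure_space_outer
    by (intro subadditiveD[OF countably_subadditive_subadditive]) (auto simp: outer_measure_space_def)
  also have "outer (F - E) \<le> outer F" by (intro outer_mono) auto
  finally show ?thesis by (simp add: add_left_mono)
qed

text \<open>The nontrivial half of Caratheodory's criterion for open sets. A function below the
  indicator of \<open>U \<inter> V\<close> is lowered by \<open>1 / Suc n\<close>; it then vanishes
  on an open set containing \<open>U - V\<close>, so functions admissible for that set can be added
  to it without exceeding the indicator of \<open>U\<close>. Finally \<open>n\<close> tends to
  infinity.\<close>

lemma outer_split_open:
  assumes V: "open V"
  shows "outer (E \<inter> V) + outer (E - V) \<le> outer E"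
proof (rule outer_greatest)
  fix U assume U: "open U" "E - A \<subseteq> U"
  have "outer (E \<inter> V) + outer (E - V) \<le> open_mass (U \<inter> V) + outer (U - V)"
    using U V by (intro add_mono outer_lower outer_mono) auto
  also have "\<dots> \<le> open_mass U"
  proof -
    have step: "ennreal (T f) + outer (U - V) \<le> open_mass U"
      if f: "f \<in> Lip_c A" "\<And>x. 0 \<le> f x" "\<And>x. f x \<le> indicator (U \<inter> V) x" for f
    proof -
      define f' where "f' n x = f x - min (f x) (1 / Suc n)" for n x
      have f': "f' n \<in> Lip_c A" for n
        unfolding f'_def by (intro Lip_c_diff Lip_c_min_const f) auto
      have f'0: "0 \<le> f' n x" for n x by (simp add: f'_def)
      have "ennreal (T (f' n)) + outer (U - V) \<le> open_mass U" for n
      proof -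
        define W where "W = U \<inter> {x. f x < 1 / Suc n}"
        have "open W" unfolding W_def
          using Lip_c_continuous[OF f(1)] U by (intro open_Int open_Collect_less) auto
        moreover have "U - V \<subseteq> W"
        proof
          fix x assume x: "x \<in> U - V"
          then have "f x \<le> 0" using f(3)[of x] by simp
          then have "f x < 1 / real (Suc n)" by (rule le_less_trans) simp
          then show "x \<in> W" using x by (simp add: W_def)
        qed
        ultimately have "outer (U - V) \<le> open_mass W" by (intro outer_lower) auto
        then have "ennreal (T (f' n)) + outer (U - V) \<le> open_mass W + ennreal (T (f' n))"
          by (simp add: add.commute add_left_mono)
        also have "\<dots> \<le> open_mass U"
        proof (rule open_mass_add_le)
          fix g assume g: "g \<in> Lip_c A" "\<And>x. 0 \<le> g x" "\<And>x. g x \<le> indicator W x"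
          \<comment> \<open>On \<open>W\<close> the lowered function is 0 and only \<open>g\<close>
            remains; off \<open>W\<close> the function \<open>g\<close> is 0 and only the lowered
            function remains.\<close>
          have le: "g x + f' n x \<le> indicator U x" for x
          proof (cases "x \<in> W")
            case True
            then show ?thesis using g(3)[of x] by (auto simp: f'_def W_def)
          next
            case False
            then have "g x = 0" using g(2,3)[of x] by simp
            moreover have "f' n x \<le> f x" by (simp add: f'_def f)
            moreover have "f x \<le> indicator U x"
              using f(3)[of x] by (rule order_trans) (simp add: indicator_def)
            ultimately show ?thesis by simp
          qed
          have "ennreal (T g) + ennreal (T (f' n)) = ennreal (T (\<lambda>x. g x + f' n x))"
            using T_nonneg[OF f' f'0] T_nonneg[OF g(1,2)] by (simp add: T_add f' g)
          also have "\<dots> \<le> open_mass U"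
            using le by (intro open_mass_upper Lip_c_add f' g) (auto simp: f'0 g)
          finally show "ennreal (T g) + ennreal (T (f' n)) \<le> open_mass U" .
        qed
        finally show ?thesis .
      qed
      moreover have "(\<lambda>n. T (f' n)) \<longlonglongrightarrow> T f"
      proof (rule T_monotone_convergence[OF f' f(1)])
        show "f' n x \<le> f' (Suc n) x" for n x
          unfolding f'_def by (intro diff_left_mono min.mono) (auto simp: field_simps)
        show "(\<lambda>n. f' n x) \<longlonglongrightarrow> f x" for x
          using tendsto_diff[OF tendsto_const tendsto_min[OF tendsto_const LIMSEQ_Suc[OF lim_1_over_n]], of "f x" "f x"] f(2)[of x]
          by (simp add: f'_def)
      qed
      ultimately show ?thesis
        by (intro LIMSEQ_le_const2[OF tendsto_add[OF tendsto_ennrealI tendsto_const]]) auto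
    qed
    show ?thesis by (rule open_mass_add_le[OF step])
  qed
  finally show "outer (E \<inter> V) + outer (E - V) \<le> open_mass U" .
qed

section \<open>The representing measure\<close>

text \<open>\<open>measure_of\<close> has the values of \<open>outer\<close> on Borel sets only if
  \<open>outer\<close> is countably additive there, which \<open>emeasure_riesz_measure\<close>
  establishes.\<close>

definition riesz_measure :: "'a measure" where
  "riesz_measure = measure_of UNIV (sets borel) outer"

lemma sets_riesz_measure [simp, measurable_cong]: "sets riesz_measure = sets borel"
  using sets.sigma_sets_eq[of "borel :: 'a measure"] by (simp add: riesz_measure_def)

text \<open>Caratheodory's theorem: the sets that split every set additively form a sigma-algebra on
  which \<open>outer\<close> is a measure. Open sets belong to it by \<open>outer_split_open\<close>
  and \<open>outer_Un\<close>, hence so do all Borel sets.\<close>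

lemma emeasure_riesz_measure:
  assumes "E \<in> sets borel"
  shows "emeasure riesz_measure E = outer E"
proof -
  let ?L = "lambda_system UNIV UNIV outer"
  interpret sigma_algebra UNIV "UNIV :: 'a set set"
    using sigma_algebra_Pow[of "UNIV :: 'a set"] by simp
  have L: "measure_space UNIV ?L outer"
    by (rule caratheodory_lemma[OF outer_measure_space_outer])
  then interpret L: sigma_algebra UNIV ?L by (simp add: measure_space_def)
  have "outer (E \<inter> V) + outer (E - V) = outer E" if "open V" for E V
    using outer_split_open[OF that, of E] outer_Un[of "E \<inter> V" "E - V"]
    by (simp add: Int_Diff_Un antisym)
  then have "{V. open V} \<subseteq> ?L"
    unfolding lambda_system_eq by auto
  then have "sets borel \<subseteq> ?L"
    unfolding borel_def by (simp add: L.sigma_sets_subset)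
  then have "measure_space UNIV (sets borel) outer"
    using measure_down[OF L, of "sets borel"] sets.sigma_algebra_axioms[of "borel :: 'a measure"] by simp
  then show ?thesis
    unfolding riesz_measure_def using assms
    by (intro emeasure_measure_of_sigma) (auto simp: measure_space_def)
qed

end

section \<open>Integral representation, uniqueness and tightness\<close>

context boundedly_compact
begin

section \<open>Exhaustion of \<open>- A\<close> and uniqueness of the representing measure\<close>

lemma infdist_A_pos: "x \<notin> A \<Longrightarrow> 0 < infdist x A"
  using closed_A A_nonempty by (rule infdist_pos_not_in_closed)

text \<open>Closed superlevel sets of \<open>infdist x A\<close>, cut off by balls around a fixed
  point off \<open>A\<close>, are closed subsets of the compact sets provided by bounded
  compactness.\<close>

lemma compact_exhaustion:
  obtains C where "\<And>n::nat. compact (C n)" "incseq C" "(\<Union>n. C n) = - A"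
    "\<And>n. C n \<subseteq> {x. 1 / Suc n \<le> infdist x A}"
proof (cases "A = UNIV")
  case True
  then show ?thesis using that[of "\<lambda>n. {}"] by simp
next
  case False
  then obtain p where p: "p \<notin> A" by auto
  define C where "C n = {x. 1 / Suc n \<le> infdist x A} \<inter> cball p (real n)" for n
  have "compact (C n)" for n
  proof -
    have "closed (C n)"
      unfolding C_def by (intro closed_Int closed_Collect_le continuous_intros) auto
    moreover have "compact (cball p (real (Suc n)) \<inter> closure {y. infdist y A > 1 / Suc n / 2})"
      using p by (intro bounded_compact) auto
    moreover have "C n \<subseteq> cball p (real (Suc n)) \<inter> closure {y. infdist y A > 1 / Suc n / 2}"
    proof -
      \<comment> \<open>Halving the level turns the non-strict inequality defining
        \<open>C n\<close> into the strict one of bounded compactness.\<close>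
      have "1 / Suc n / 2 < 1 / real (Suc n)" by (simp add: field_simps)
      then have "C n \<subseteq> cball p (real (Suc n)) \<inter> {y. infdist y A > 1 / Suc n / 2}"
        unfolding C_def by fastforce
      then show ?thesis using closure_subset by blast
    qed
    ultimately show ?thesis by (metis compact_Int_closed inf.absorb_iff2)
  qed
  moreover have "incseq C"
  proof (rule incseq_SucI)
    fix n
    have "1 / real (Suc (Suc n)) \<le> 1 / real (Suc n)"
      by (intro divide_left_mono) auto
    then show "C n \<subseteq> C (Suc n)" unfolding C_def by fastforce
  qed
  moreover have "(\<Union>n. C n) = - A"
  proof (intro equalityI subsetI)
    fix x assume "x \<in> (\<Union>n. C n)"
    then obtain n where "1 / Suc n \<le> infdist x A" by (auto simp: C_def)
    moreover have "0 < 1 / real (Suc n)" by simp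
    ultimately have "infdist x A \<noteq> 0" by linarith
    then show "x \<in> - A" by auto
  next
    fix x assume "x \<in> - A"
    then have "0 < infdist x A" by (intro infdist_A_pos) auto
    then obtain m where m: "1 / Suc m < infdist x A" using nat_approx_posE by blast
    define n where "n = max m (nat \<lceil>dist p x\<rceil>)"
    have "1 / real (Suc n) \<le> 1 / real (Suc m)"
      by (intro divide_left_mono) (auto simp: n_def)
    moreover have "dist p x \<le> real n" unfolding n_def by linarith
    ultimately have "x \<in> C n" using m by (auto simp: C_def)
    then show "x \<in> (\<Union>n. C n)" by blast
  qed
  moreover have "C n \<subseteq> {x. 1 / Suc n \<le> infdist x A}" for n by (auto simp: C_def)
  ultimately show ?thesis using that by blast
qed

text \<open>Markov's inequality for the function \<open>infdist x A\<close>.\<close>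

lemma emeasure_finite_off_A:
  assumes \<rho>: "sets \<rho> = sets borel" and fin: "(\<integral>\<^sup>+x. ennreal (infdist x A) \<partial>\<rho>) < \<infinity>"
    and C: "C \<in> sets borel" "C \<subseteq> {x. \<delta> \<le> infdist x A}" and "0 < \<delta>"
  shows "emeasure \<rho> C < \<infinity>"
proof -
  have "ennreal \<delta> * emeasure \<rho> C = (\<integral>\<^sup>+x. ennreal \<delta> * indicator C x \<partial>\<rho>)"
    using C \<rho> by (simp add: nn_integral_cmult_indicator)
  also have "\<dots> \<le> (\<integral>\<^sup>+x. ennreal (infdist x A) \<partial>\<rho>)"
    using C(2) by (intro nn_integral_mono) (auto simp: indicator_def intro!: ennreal_leI)
  finally have "ennreal \<delta> * emeasure \<rho> C < \<infinity>" using fin by (rule le_less_trans)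
  then show ?thesis using \<open>0 < \<delta>\<close> by (auto simp: ennreal_mult_less_top less_top)
qed

text \<open>By monotone convergence the mass of \<open>U\<close> is a limit of values of
  \<open>T\<close>, hence the same for every measure representing \<open>T\<close>.\<close>

lemma emeasure_open_limit:
  assumes \<rho>: "sets \<rho> = sets borel"
    and int: "\<And>f. f \<in> Lip_c A \<Longrightarrow> has_bochner_integral \<rho> f (T f)"
    and u: "\<And>n. u n \<in> Lip_c A" "\<And>n x. 0 \<le> u n x" "\<And>n x. u n x \<le> u (Suc n) x"
      "\<And>x. (\<lambda>n. u n x) \<longlonglongrightarrow> indicator U x" and U: "U \<in> sets borel"
  shows "(\<lambda>n. ennreal (T (u n))) \<longlonglongrightarrow> emeasure \<rho> U"
proof -
  have "(\<lambda>n. \<integral>\<^sup>+x. ennreal (u n x) \<partial>\<rho>) \<longlonglongrightarrow> (\<integral>\<^sup>+x. ennreal (indicator U x) \<partial>\<rho>)"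
    using Lip_c_measurable[OF u(1)] u(3)
    by (intro nn_integral_LIMSEQ incseq_SucI le_funI ennreal_leI tendsto_ennrealI u)
      (auto simp: measurable_cong_sets[OF \<rho> refl])
  moreover have "(\<integral>\<^sup>+x. ennreal (u n x) \<partial>\<rho>) = ennreal (T (u n))" for n
    using int[OF u(1), of n] u(2) by (subst nn_integral_eq_integral) (auto simp: has_bochner_integral_iff)
  moreover have "(\<integral>\<^sup>+x. ennreal (indicator U x) \<partial>\<rho>) = emeasure \<rho> U"
    using U \<rho> by (simp add: ennreal_indicator)
  ultimately show ?thesis by simp
qed

text \<open>Representing measures agree on open sets off \<open>A\<close>, but the total mass may be
  infinite. The uniqueness theorem for intersection-stable generators is therefore applied to the
  restrictions to superlevel sets of \<open>infdist x A\<close>, which have finite mass by Markov's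
  inequality and increase to \<open>- A\<close>.\<close>

lemma representing_measure_unique:
  assumes \<mu>: "sets \<mu> = sets borel" "(\<integral>\<^sup>+x. ennreal (infdist x A) \<partial>\<mu>) < \<infinity>"
      "\<And>f. f \<in> Lip_c A \<Longrightarrow> has_bochner_integral \<mu> f (T f)"
    and \<nu>: "sets \<nu> = sets borel" "\<And>f. f \<in> Lip_c A \<Longrightarrow> has_bochner_integral \<nu> f (T f)"
    and E: "E \<in> sets borel" "E \<subseteq> - A"
  shows "emeasure \<mu> E = emeasure \<nu> E"
proof -
  have opens: "emeasure \<mu> U = emeasure \<nu> U" if U: "open U" "U \<subseteq> - A" for U
  proof -
    obtain u where u: "\<And>n. u n \<in> Lip_c A" "\<And>n x. (0::real) \<le> u n x"
      "\<And>n x. u n x \<le> u (Suc n) x" "\<And>x. (\<lambda>n. u n x) \<longlonglongrightarrow> indicator (U - A) x"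
      using approx_open[OF U(1)] by metis
    have "U - A = U" using U by auto
    with u(4) have u4: "(\<lambda>n. u n x) \<longlonglongrightarrow> indicator U x" for x by simp
    show ?thesis
      using emeasure_open_limit[OF \<mu>(1,3) u(1-3) u4] emeasure_open_limit[OF \<nu> u(1-3) u4] U
      by (intro LIMSEQ_unique) auto
  qed
  define D where "D n = {x. 1 / Suc n < infdist x A}" for n
  have D: "open (D n)" "D n \<subseteq> - A" for n
  proof -
    show "open (D n)" unfolding D_def by (intro open_Collect_less continuous_intros)
    show "D n \<subseteq> - A" by (auto simp: D_def)
  qed
  have eq: "density \<mu> (indicator (D n)) = density \<nu> (indicator (D n))" for n
  proof (rule measure_eqI_generator_eq[where E = "{U. open U}" and \<Omega> = UNIV and A = "\<lambda>_. UNIV"])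
    show "Int_stable {U :: 'a set. open U}" by (auto simp: Int_stable_def)
    \<comment> \<open>The restricted measures evaluate \<open>U\<close> on
      \<open>D n \<inter> U\<close>, an open set off \<open>A\<close>.\<close>
    show "emeasure (density \<mu> (indicator (D n))) U = emeasure (density \<nu> (indicator (D n))) U"
      if "U \<in> {U. open U}" for U
      using that D[of n] \<mu>(1) \<nu>(1)
      by (subst (1 2) emeasure_restricted) (auto intro!: opens)
    have "emeasure \<mu> (D n) < \<infinity>"
      using D[of n] by (intro emeasure_finite_off_A[OF \<mu>(1,2), of _ "1 / Suc n"]) (auto simp: D_def)
    then show "emeasure (density \<mu> (indicator (D n))) UNIV \<noteq> \<infinity>"
      using D[of n] \<mu>(1) by (subst emeasure_restricted) auto
  qed (use \<mu> \<nu> in \<open>auto simp: borel_def\<close>)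
  have eqD: "emeasure \<mu> (D n \<inter> E) = emeasure \<nu> (D n \<inter> E)" for n
    using arg_cong[OF eq[of n], of "\<lambda>M. emeasure M E"] D[of n] E \<mu>(1) \<nu>(1)
    by (simp add: emeasure_restricted)
  have inc: "incseq (\<lambda>n. D n \<inter> E)"
  proof (rule incseq_SucI)
    fix n
    have "1 / real (Suc (Suc n)) \<le> 1 / real (Suc n)"
      by (intro divide_left_mono) auto
    then show "D n \<inter> E \<subseteq> D (Suc n) \<inter> E" unfolding D_def by fastforce
  qed
  have "E \<subseteq> (\<Union>n. D n)"
  proof
    fix x assume "x \<in> E"
    then have "0 < infdist x A" using E by (intro infdist_A_pos) auto
    then show "x \<in> (\<Union>n. D n)" using nat_approx_posE unfolding D_def by blast
  qed
  then have UN: "(\<Union>n. D n \<inter> E) = E" by blast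
  have lim: "(\<lambda>n. emeasure \<rho> (D n \<inter> E)) \<longlonglongrightarrow> emeasure \<rho> E" if "sets \<rho> = sets borel" for \<rho>
    using Lim_emeasure_incseq[OF _ inc, of \<rho>] D E that UN by (simp add: image_subset_iff)
  show ?thesis
    using LIMSEQ_unique[OF lim[OF \<mu>(1)]] lim[OF \<nu>(1)] by (simp add: eqD)
qed

end

context daniell_functional
begin

section \<open>Comparison of \<open>T\<close> with integration by horizontal layers\<close>

lemma riesz_measure_open: "open U \<Longrightarrow> emeasure riesz_measure U = open_mass U"
  by (simp add: emeasure_riesz_measure outer_open)

text \<open>If \<open>f\<close> is admissible for \<open>U\<close>, then \<open>c * f\<close> lies
  below \<open>g\<close>. The reverse estimate \<open>T_le_riesz_measure\<close> uses that
  \<open>g / c\<close> is itself admissible.\<close>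

lemma riesz_measure_le_T:
  assumes "g \<in> Lip_c A" "\<And>x. c * indicator U x \<le> g x" "0 < c" "open U"
  shows "ennreal c * emeasure riesz_measure U \<le> ennreal (T g)"
proof -
  have "ennreal c * ennreal (T f) \<le> ennreal (T g)"
    if f: "f \<in> Lip_c A" "\<And>x. 0 \<le> f x" "\<And>x. f x \<le> indicator U x" for f
  proof -
    have "T (\<lambda>x. c * f x) \<le> T g"
    proof (intro T_mono Lip_c_cmult assms f)
      show "c * f x \<le> g x" for x
        using mult_left_mono[OF f(3)[of x], of c] assms(2)[of x] \<open>0 < c\<close> by linarith
    qed
    then show ?thesis
      using assms(3) f by (simp add: T_cmult T_nonneg ennreal_leI flip: ennreal_mult)
  qed
  then show ?thesis
    unfolding riesz_measure_open[OF assms(4)] open_mass_def SUP_mult_left_ennreal by (intro SUP_least) auto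
qed

lemma T_le_riesz_measure:
  assumes g: "g \<in> Lip_c A" "\<And>x. 0 \<le> g x" "\<And>x. g x \<le> c * indicator U x" and "0 < c" "open U"
  shows "ennreal (T g) \<le> ennreal c * emeasure riesz_measure U"
proof -
  have "ennreal (T (\<lambda>x. 1 / c * g x)) \<le> open_mass U"
    using assms by (intro open_mass_upper Lip_c_cmult) (auto simp: field_simps)
  then have "ennreal c * ennreal (1 / c * T g) \<le> ennreal c * open_mass U"
    unfolding T_cmult[OF g(1)] by (intro mult_left_mono) auto
  then show ?thesis
    using \<open>0 < c\<close> T_nonneg[OF g(1,2)] by (simp add: riesz_measure_open assms flip: ennreal_mult)
qed

text \<open>What \<open>T\<close> and integration against \<open>riesz_measure\<close> have in
  common: additivity, monotone convergence, and comparison with the measure of open sets. These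
  properties determine the values on nonnegative members of \<open>Lip_c A\<close>, see
  \<open>integral_like_unique\<close>. Values lie in \<open>ennreal\<close> since finiteness of the
  integrals is still to be shown.\<close>

definition integral_like :: "(('a \<Rightarrow> real) \<Rightarrow> ennreal) \<Rightarrow> bool" where
  "integral_like S \<longleftrightarrow>
     (\<forall>f g. f \<in> Lip_c A \<longrightarrow> g \<in> Lip_c A \<longrightarrow> (\<forall>x. 0 \<le> f x) \<longrightarrow> (\<forall>x. 0 \<le> g x) \<longrightarrow>
        S (\<lambda>x. f x + g x) = S f + S g) \<and>
     (\<forall>f g. (\<forall>n. f n \<in> Lip_c A) \<longrightarrow> g \<in> Lip_c A \<longrightarrow> (\<forall>n x. 0 \<le> f n x) \<longrightarrow>
        (\<forall>n x. f n x \<le> f (Suc n) x) \<longrightarrow> (\<forall>x. (\<lambda>n. f n x) \<longlonglongrightarrow> g x) \<longrightarrow> (\<lambda>n. S (f n)) \<longlonglongrightarrow> S g) \<and>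
     (\<forall>g U c. g \<in> Lip_c A \<longrightarrow> (\<forall>x. 0 \<le> g x) \<longrightarrow> open U \<longrightarrow> 0 < c \<longrightarrow>
        ((\<forall>x. c * indicator U x \<le> g x) \<longrightarrow> ennreal c * emeasure riesz_measure U \<le> S g) \<and>
        ((\<forall>x. g x \<le> c * indicator U x) \<longrightarrow> S g \<le> ennreal c * emeasure riesz_measure U))"

lemma
  assumes "integral_like S"
  shows integral_like_add: "f \<in> Lip_c A \<Longrightarrow> g \<in> Lip_c A \<Longrightarrow> (\<And>x. 0 \<le> f x) \<Longrightarrow> (\<And>x. 0 \<le> g x) \<Longrightarrow>
        S (\<lambda>x. f x + g x) = S f + S g"
    and integral_like_lim: "(\<And>n. h n \<in> Lip_c A) \<Longrightarrow> g \<in> Lip_c A \<Longrightarrow> (\<And>n x. 0 \<le> h n x) \<Longrightarrow>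
        (\<And>n x. h n x \<le> h (Suc n) x) \<Longrightarrow> (\<And>x. (\<lambda>n. h n x) \<longlonglongrightarrow> g x) \<Longrightarrow> (\<lambda>n. S (h n)) \<longlonglongrightarrow> S g"
    and integral_like_lower: "g \<in> Lip_c A \<Longrightarrow> (\<And>x. 0 \<le> g x) \<Longrightarrow> open U \<Longrightarrow> 0 < c \<Longrightarrow>
        (\<And>x. c * indicator U x \<le> g x) \<Longrightarrow> ennreal c * emeasure riesz_measure U \<le> S g"
    and integral_like_upper: "g \<in> Lip_c A \<Longrightarrow> (\<And>x. 0 \<le> g x) \<Longrightarrow> open U \<Longrightarrow> 0 < c \<Longrightarrow>
        (\<And>x. g x \<le> c * indicator U x) \<Longrightarrow> S g \<le> ennreal c * emeasure riesz_measure U"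
  using assms unfolding integral_like_def by simp_all

lemma integral_like_mono:
  assumes S: "integral_like S" and "f \<in> Lip_c A" "g \<in> Lip_c A" "\<And>x. 0 \<le> f x" "\<And>x. f x \<le> g x"
  shows "S f \<le> S g"
proof -
  have "S (\<lambda>x. f x + (g x - f x)) = S f + S (\<lambda>x. g x - f x)"
    using assms by (intro integral_like_add[OF S] Lip_c_diff) auto
  then show ?thesis by simp
qed

lemma integral_like_0: "integral_like S \<Longrightarrow> S (\<lambda>x. 0) = 0"
  using integral_like_upper[of S "\<lambda>x. 0" "{}" 1] by (simp add: Lip_c_0)

lemma integral_like_sum:
  assumes S: "integral_like S" and "finite I" "\<And>i. i \<in> I \<Longrightarrow> f i \<in> Lip_c A" "\<And>i x. i \<in> I \<Longrightarrow> 0 \<le> f i x"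
  shows "S (\<lambda>x. \<Sum>i\<in>I. f i x) = (\<Sum>i\<in>I. S (f i))"
  using assms(2-4)
proof (induction I rule: finite_induct)
  case empty
  then show ?case using integral_like_0[OF S] by simp
next
  case (insert i I)
  then have "S (\<lambda>x. f i x + (\<Sum>i\<in>I. f i x)) = S (f i) + S (\<lambda>x. \<Sum>i\<in>I. f i x)"
    by (intro integral_like_add[OF S] Lip_c_sum) (auto intro: sum_nonneg)
  then show ?case using insert by simp
qed

text \<open>Cut \<open>f\<close> into horizontal layers of height \<open>\<epsilon>\<close>: the value of \<open>S'\<close> on one layer and that of \<open>S\<close>
  on the layer below are separated by \<open>\<epsilon>\<close> times the measure of the superlevel set between them.\<close>

lemma integral_like_layers:
  assumes S: "integral_like S" "integral_like S'" and f: "f \<in> Lip_c A" "\<And>x. 0 \<le> f x" and "0 < \<epsilon>"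
  shows "S' (\<lambda>x. f x - min (f x) \<epsilon>) \<le> S f"
proof -
  obtain B where B: "\<And>x. f x \<le> B" using Lip_c_le_bound[OF f(1)] by blast
  obtain N :: nat where N: "B < N * \<epsilon>" using reals_Archimedean3[OF \<open>0 < \<epsilon>\<close>] by blast
  define cut where "cut k x = min (f x) (real k * \<epsilon>)" for k x
  define s where "s k x = cut (Suc k) x - cut k x" for k x
  have cut: "cut k \<in> Lip_c A" for k unfolding cut_def using \<open>0 < \<epsilon>\<close> by (intro Lip_c_min_const f) simp
  have s: "s k \<in> Lip_c A" for k unfolding s_def by (intro Lip_c_diff cut)
  have s0: "0 \<le> s k x" for k x using \<open>0 < \<epsilon>\<close> by (auto simp: s_def cut_def min_def algebra_simps)
  \<comment> \<open>The lowest layer \<open>s 0\<close> equals \<open>min (f x) \<epsilon>\<close>.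
    Without it, layers 1 to \<open>N\<close> remain, and they reach the top of \<open>f\<close>
    because \<open>B < N * \<epsilon>\<close>. The shift pairs layer \<open>Suc k\<close> for
    \<open>S'\<close> with layer \<open>k\<close> for \<open>S\<close>.\<close>
  have "f x - min (f x) \<epsilon> = (\<Sum>k<N. s (Suc k) x)" for x
  proof -
    have "(\<Sum>k<N. s (Suc k) x) = cut (Suc N) x - cut (Suc 0) x"
      unfolding s_def by (rule sum_lessThan_telescope)
    moreover have "f x \<le> real (Suc N) * \<epsilon>" using B[of x] N \<open>0 < \<epsilon>\<close> by (simp add: algebra_simps)
    ultimately show ?thesis by (simp add: cut_def min_absorb1)
  qed
  then have "S' (\<lambda>x. f x - min (f x) \<epsilon>) = (\<Sum>k<N. S' (s (Suc k)))"
    using s s0 by (simp add: integral_like_sum[OF S(2)])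
  also have "\<dots> \<le> (\<Sum>k<N. S (s k))"
  proof (rule sum_mono)
    fix k
    \<comment> \<open>\<open>s (Suc k)\<close> vanishes off this set, while \<open>s k\<close> is
      equal to \<epsilon> on it.\<close>
    define U where "U = {x. real (Suc k) * \<epsilon> < f x}"
    have "open U" unfolding U_def
      using Lip_c_continuous[OF f(1)] by (intro open_Collect_less continuous_intros)
    then have "S' (s (Suc k)) \<le> ennreal \<epsilon> * emeasure riesz_measure U"
      using \<open>0 < \<epsilon>\<close> s s0 by (intro integral_like_upper[OF S(2)])
        (auto simp: U_def s_def cut_def min_def indicator_def algebra_simps)
    also have "\<dots> \<le> S (s k)"
      using \<open>0 < \<epsilon>\<close> s s0 f(2) \<open>open U\<close> s0[of k] by (intro integral_like_lower[OF S(1)])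
        (auto simp: U_def s_def cut_def min_def indicator_def algebra_simps)
    finally show "S' (s (Suc k)) \<le> S (s k)" .
  qed
  also have "\<dots> = S (\<lambda>x. \<Sum>k<N. s k x)"
    using s s0 by (simp add: integral_like_sum[OF S(1)])
  also have "\<dots> \<le> S f"
  proof (rule integral_like_mono[OF S(1) _ f(1)])
    show "(\<lambda>x. \<Sum>k<N. s k x) \<in> Lip_c A" using s by (intro Lip_c_sum) auto
    show "0 \<le> (\<Sum>k<N. s k x)" for x using s0 by (intro sum_nonneg)
    have "(\<Sum>k<N. s k x) = cut N x - cut 0 x" for x
      unfolding s_def by (rule sum_lessThan_telescope)
    then show "(\<Sum>k<N. s k x) \<le> f x" for x using f(2)[of x] by (simp add: cut_def)
  qed
  finally show ?thesis .
qed

text \<open>\<open>integral_like_layers\<close> bounds \<open>S'\<close> of the lowered function by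
  \<open>S f\<close>. Lowering by less and less gives \<open>S' f \<le> S f\<close> by monotone
  convergence, and the situation is symmetric in \<open>S\<close> and \<open>S'\<close>.\<close>

lemma integral_like_unique:
  assumes "integral_like S" "integral_like S'" and f: "f \<in> Lip_c A" "\<And>x. 0 \<le> f x"
  shows "S f = S' f"
proof -
  have "S' f \<le> S f" if S: "integral_like S" "integral_like S'" for S S'
  proof (rule LIMSEQ_le_const2)
    show "(\<lambda>n. S' (\<lambda>x. f x - min (f x) (1 / Suc n))) \<longlonglongrightarrow> S' f"
    proof (rule integral_like_lim[OF S(2) _ f(1)])
      show "(\<lambda>x. f x - min (f x) (1 / Suc n)) \<in> Lip_c A" for n
        using f by (intro Lip_c_diff Lip_c_min_const) auto
      show "f x - min (f x) (1 / Suc n) \<le> f x - min (f x) (1 / Suc (Suc n))" for n x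
        by (intro diff_left_mono min.mono) (auto simp: field_simps)
      show "(\<lambda>n. f x - min (f x) (1 / Suc n)) \<longlonglongrightarrow> f x" for x
        using tendsto_diff[OF tendsto_const tendsto_min[OF tendsto_const LIMSEQ_Suc[OF lim_1_over_n]], of "f x" "f x"] f(2)[of x]
        by simp
    qed auto
    show "\<exists>N. \<forall>n\<ge>N. S' (\<lambda>x. f x - min (f x) (1 / Suc n)) \<le> S f"
      using integral_like_layers[OF S f] by auto
  qed
  then show ?thesis using assms(1,2) by (intro antisym) auto
qed

lemma integral_like_T: "integral_like (\<lambda>f. ennreal (T f))"
  unfolding integral_like_def
  using T_monotone_convergence
  by (auto simp: T_add T_nonneg riesz_measure_le_T T_le_riesz_measure intro!: tendsto_ennrealI)

lemma integral_like_nn_integral: "integral_like (\<lambda>f. \<integral>\<^sup>+x. ennreal (f x) \<partial>riesz_measure)"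
proof -
  note [measurable] = Lip_c_measurable
  have "(\<integral>\<^sup>+x. ennreal (f x + g x) \<partial>riesz_measure) =
      (\<integral>\<^sup>+x. ennreal (f x) \<partial>riesz_measure) + (\<integral>\<^sup>+x. ennreal (g x) \<partial>riesz_measure)"
    if "f \<in> Lip_c A" "g \<in> Lip_c A" "\<forall>x. 0 \<le> f x" "\<forall>x. 0 \<le> g x" for f g
    using that by (subst nn_integral_add[symmetric]) auto
  moreover have "(\<lambda>n. \<integral>\<^sup>+x. ennreal (f n x) \<partial>riesz_measure) \<longlonglongrightarrow> (\<integral>\<^sup>+x. ennreal (g x) \<partial>riesz_measure)"
    if "\<forall>n. f n \<in> Lip_c A" "\<forall>n x. f n x \<le> f (Suc n) x" "\<forall>x. (\<lambda>n. f n x) \<longlonglongrightarrow> g x" for f g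
    using that Lip_c_measurable[of "f _" A]
    by (intro nn_integral_LIMSEQ incseq_SucI le_funI ennreal_leI tendsto_ennrealI) auto
  moreover have cmult: "ennreal c * emeasure riesz_measure U = (\<integral>\<^sup>+x. ennreal (c * indicator U x) \<partial>riesz_measure)"
    if "open U" "0 < c" for c U
    using that by (simp add: ennreal_mult ennreal_indicator nn_integral_cmult_indicator)
  ultimately show ?thesis
    unfolding integral_like_def by (auto simp: cmult intro!: nn_integral_mono ennreal_leI)
qed

text \<open>For nonnegative functions the two integral-like functionals coincide, and finiteness of
  \<open>T\<close> gives integrability. A general \<open>f\<close> is the difference of
  \<open>max (f x) 0\<close> and \<open>max (f x) 0 - f x\<close>, both nonnegative and in
  \<open>Lip_c A\<close>.\<close>

lemma has_bochner_integral_riesz_measure: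
  assumes f: "f \<in> Lip_c A"
  shows "has_bochner_integral riesz_measure f (T f)"
proof -
  have nonneg: "has_bochner_integral riesz_measure g (T g)" if g: "g \<in> Lip_c A" "\<And>x. 0 \<le> g x" for g
  proof (rule has_bochner_integral_nn_integral)
    show "(\<integral>\<^sup>+x. ennreal (g x) \<partial>riesz_measure) = ennreal (T g)"
      using integral_like_unique[OF integral_like_nn_integral integral_like_T g] .
    show "g \<in> borel_measurable riesz_measure" using Lip_c_measurable[OF g(1)] by simp
  qed (use g T_nonneg in auto)
  have p: "(\<lambda>x. max (f x) 0) \<in> Lip_c A" using Lip_c_max[OF f Lip_c_0] .
  have m: "(\<lambda>x. max (f x) 0 - f x) \<in> Lip_c A" using Lip_c_diff[OF p f] .
  have "has_bochner_integral riesz_measure (\<lambda>x. max (f x) 0 - (max (f x) 0 - f x))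
      (T (\<lambda>x. max (f x) 0) - T (\<lambda>x. max (f x) 0 - f x))"
    by (intro has_bochner_integral_diff nonneg p m) auto
  then show ?thesis by (simp add: T_diff[OF p f])
qed

section \<open>Finite first moment and tightness\<close>

lemma riesz_measure_finite_moment:
  assumes "Lip_bounded_functional_on (Lip_c A) T"
  shows "(\<integral>\<^sup>+x. ennreal (infdist x A) \<partial>riesz_measure) < \<infinity>"
proof -
  obtain M where M: "\<And>f. f \<in> Lip_c A \<Longrightarrow> \<bar>T f\<bar> \<le> M * Lip_number f"
    using assms by (auto simp: Lip_bounded_functional_on_def)
  obtain \<psi> where \<psi>: "\<And>n. \<psi> n \<in> Lip_c A" "\<And>n x y. \<bar>\<psi> n x - \<psi> n y\<bar> \<le> dist x y"
    "\<And>n x. (0::real) \<le> \<psi> n x" "\<And>n x. \<psi> n x \<le> \<psi> (Suc n) x" "\<And>x. (\<lambda>n. \<psi> n x) \<longlonglongrightarrow> infdist x A"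
    using approx_infdist[OF closed_A order_refl] by metis
  have "(\<lambda>n. \<integral>\<^sup>+x. ennreal (\<psi> n x) \<partial>riesz_measure) \<longlonglongrightarrow> (\<integral>\<^sup>+x. ennreal (infdist x A) \<partial>riesz_measure)"
    using \<psi>(4) Lip_c_measurable[OF \<psi>(1)]
    by (intro nn_integral_LIMSEQ incseq_SucI le_funI ennreal_leI tendsto_ennrealI \<psi>) auto
  moreover have "(\<integral>\<^sup>+x. ennreal (\<psi> n x) \<partial>riesz_measure) \<le> ennreal \<bar>M\<bar>" for n
  proof -
    have lip: "1-lipschitz_on UNIV (\<psi> n)"
      using \<psi>(2) by (auto simp: lipschitz_on_def dist_real_def)
    have "Lip_number (\<psi> n) \<le> 1" unfolding Lip_number_def
      using lip by (intro cInf_lower bdd_belowI[of _ 0]) (auto dest: lipschitz_on_nonneg)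
    moreover have "0 \<le> Lip_number (\<psi> n)" unfolding Lip_number_def
      using lip by (intro cInf_greatest) (auto dest: lipschitz_on_nonneg)
    \<comment> \<open>The constant \<open>M\<close> may be negative, so the bound independent of
      \<open>n\<close> is stated with its absolute value.\<close>
    ultimately have "M * Lip_number (\<psi> n) \<le> \<bar>M\<bar> * 1"
      by (intro mult_mono) auto
    then have "T (\<psi> n) \<le> \<bar>M\<bar>" using M[OF \<psi>(1), of n] by simp
    then show ?thesis
      using integral_like_unique[OF integral_like_nn_integral integral_like_T \<psi>(1,3), of n] by (simp add: ennreal_leI)
  qed
  ultimately have "(\<integral>\<^sup>+x. ennreal (infdist x A) \<partial>riesz_measure) \<le> ennreal \<bar>M\<bar>"
    by (intro LIMSEQ_le_const2) auto
  then show ?thesis by (rule le_less_trans) simp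
qed

text \<open>Inner regularity by complements within a compact \<open>C n\<close> of finite mass: if
  an open \<open>U\<close> covers \<open>C n - E\<close> with excess mass below \<open>e\<close>,
  then \<open>C n - U\<close> is a compact subset of \<open>E\<close> and misses at most
  \<open>e\<close> of the mass of \<open>C n \<inter> E\<close>. The sets \<open>C n\<close> exhaust
  \<open>- A\<close>, which contains \<open>E\<close>.\<close>

lemma riesz_measure_tight:
  assumes fin: "(\<integral>\<^sup>+x. ennreal (infdist x A) \<partial>riesz_measure) < \<infinity>" and E: "E \<in> sets borel" "E \<subseteq> - A"
  shows "emeasure riesz_measure E = (SUP K\<in>{K. compact K \<and> K \<subseteq> E}. emeasure riesz_measure K)" (is "_ = ?S")
proof (rule antisym)
  obtain C where C: "\<And>n::nat. compact (C n)" "incseq C" "(\<Union>n. C n) = - A"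
    "\<And>n. C n \<subseteq> {x. 1 / Suc n \<le> infdist x A}"
    using compact_exhaustion by metis
  have C_borel: "C n \<in> sets borel" for n
    using C(1) by (simp add: borel_compact)
  have "emeasure riesz_measure (C n \<inter> E) \<le> ?S" for n
  proof (rule ennreal_le_epsilon)
    fix e :: real assume "0 < e"
    have "emeasure riesz_measure (C n) < \<infinity>"
      using C(4) C_borel by (intro emeasure_finite_off_A[OF _ fin, where \<delta> = "1 / Suc n"]) auto
    then have CE: "emeasure riesz_measure (C n - E) < \<infinity>"
      using C_borel by (intro le_less_trans[OF emeasure_mono[of "C n - E" "C n"]]) auto
    then have "outer (C n - E) < emeasure riesz_measure (C n - E) + ennreal e"
      using \<open>0 < e\<close> C_borel E by (simp add: emeasure_riesz_measure less_top)
    then obtain U where U: "open U" "C n - E - A \<subseteq> U"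
      and less: "open_mass U < emeasure riesz_measure (C n - E) + ennreal e"
      unfolding outer_def INF_less_iff by auto
    have "compact (C n - U)" using C(1) U(1) by (rule compact_diff)
    moreover have "C n - U \<subseteq> E" using U(2) C(3) by blast
    ultimately have K: "emeasure riesz_measure (C n - U) \<le> ?S" by (intro SUP_upper) auto
    have "emeasure riesz_measure (C n - E) + emeasure riesz_measure (C n \<inter> E) = emeasure riesz_measure (C n)"
      using C_borel E by (subst plus_emeasure) (auto intro!: arg_cong[of _ _ "emeasure riesz_measure"])
    also have "\<dots> \<le> emeasure riesz_measure ((C n - U) \<union> U)"
      using C_borel U by (intro emeasure_mono) auto
    also have "\<dots> \<le> emeasure riesz_measure (C n - U) + emeasure riesz_measure U"
      using C_borel U by (intro emeasure_subadditive) auto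
    also have "\<dots> \<le> ?S + (emeasure riesz_measure (C n - E) + ennreal e)"
      using K less U by (intro add_mono) (auto simp: riesz_measure_open)
    also have "\<dots> = emeasure riesz_measure (C n - E) + (?S + ennreal e)"
      by (simp add: ac_simps)
    \<comment> \<open>The common summand is the mass of \<open>C n - E\<close>; it is finite and
      hence can be cancelled.\<close>
    finally show "emeasure riesz_measure (C n \<inter> E) \<le> ?S + ennreal e"
      using CE unfolding ennreal_add_left_cancel_le by auto
  qed
  moreover have "(\<lambda>n. emeasure riesz_measure (C n \<inter> E)) \<longlonglongrightarrow> emeasure riesz_measure (\<Union>n. C n \<inter> E)"
  proof (rule Lim_emeasure_incseq)
    show "incseq (\<lambda>n. C n \<inter> E)" using C(2) by (auto simp: incseq_def)
  qed (use C_borel E in auto)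
  moreover have "(\<Union>n. C n \<inter> E) = E" using C(3) E(2) by blast
  ultimately show "emeasure riesz_measure E \<le> ?S"
    by (intro LIMSEQ_le_const2) auto
  show "?S \<le> emeasure riesz_measure E"
    using E by (intro SUP_least emeasure_mono) auto
qed

end

section \<open>Passage from the measure to its class modulo measures on \<open>A\<close>\<close>

theorem theorem5p26:
  fixes A :: "'a::metric_space set" and T :: "('a \<Rightarrow> real) \<Rightarrow> real"
  assumes "metric_pair A" and "A \<noteq> {}" and "boundedly_compact_pair A"
    and "linear_functional_on (Lip_c A) T"
    and "positive_functional_on (Lip_c A) T"
    and "Lip_bounded_functional_on (Lip_c A) T"
    and "seq_order_continuous_on (Lip_c A) T"
  shows "\<exists>!\<mu>. \<mu> \<in> M1_plus A \<and> (\<forall>f\<in>Lip_c A. has_rel_integral \<mu> f (T f))"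
proof -
  interpret daniell_functional A T
    using assms by unfold_locales (auto simp: metric_pair_def boundedly_compact_pair_def)
  note eqv = equiv_rel_equiv[OF closed_A]
  have rm: "riesz_measure \<in> borel_measures" by (simp add: borel_measures_def)
  \<comment> \<open>All members of this class agree with \<open>riesz_measure\<close> on Borel sets
    off \<open>A\<close>, which is what transfers tightness, the moment bound and the integral
    formula to them.\<close>
  define m where "m = rel_equiv A `` {riesz_measure}"
  have m: "m \<in> rel_borel_measures A"
    unfolding m_def rel_borel_measures_def using rm by (rule quotientI)
  have m_iff: "\<nu> \<in> m \<longleftrightarrow> (riesz_measure, \<nu>) \<in> rel_equiv A" for \<nu> by (simp add: m_def)
  have fin: "(\<integral>\<^sup>+x. ennreal (infdist x A) \<partial>riesz_measure) < \<infinity>"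
    using assms(6) by (rule riesz_measure_finite_moment)
  have meas: "(\<lambda>x. ennreal (infdist x A)) \<in> borel_measurable borel"
    by (intro measurable_compose[OF _ measurable_ennreal] borel_measurable_continuous_onI continuous_intros)
  have "rel_tight A m"
    unfolding rel_tight_def
  proof (intro ballI impI)
    fix \<nu> E assume \<nu>: "\<nu> \<in> m" and E: "E \<in> sets borel" "E \<subseteq> - A"
    have "\<nu> \<in> borel_measures" using \<nu> by (auto simp: m_iff rel_equiv_def)
    then have eq: "emeasure \<nu> F = emeasure riesz_measure F" if "F \<in> sets borel" "F \<subseteq> - A" for F
      using \<nu> that rel_equiv_iff[OF closed_A rm] by (simp add: m_iff)
    \<comment> \<open>Compact subsets of \<open>E\<close> are Borel sets off \<open>A\<close>, so
      the supremum does not depend on the representative.\<close>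
    have "(SUP K\<in>{K. compact K \<and> K \<subseteq> E}. emeasure \<nu> K) = (SUP K\<in>{K. compact K \<and> K \<subseteq> E}. emeasure riesz_measure K)"
      using E(2) by (intro SUP_cong refl eq) (auto simp: borel_compact)
    then show "emeasure \<nu> E = (SUP K\<in>{K. compact K \<and> K \<subseteq> E}. emeasure \<nu> K)"
      using riesz_measure_tight[OF fin E] eq[OF E] by simp
  qed
  moreover have "(\<integral>\<^sup>+x. ennreal (infdist x A) \<partial>\<nu>) < \<infinity>" if "\<nu> \<in> m" for \<nu>
    using fin nn_integral_rel_equiv[OF closed_A, of riesz_measure \<nu> "\<lambda>x. ennreal (infdist x A)"] that
    by (simp add: m_iff meas)
  ultimately have "m \<in> M1_plus A"
    using m by (auto simp: M1_plus_def)
  moreover have "has_rel_integral m f (T f)" if f: "f \<in> Lip_c A" for f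
    unfolding has_rel_integral_def
    using has_bochner_integral_riesz_measure[OF f]
      has_bochner_integral_rel_equiv[OF closed_A _ Lip_c_measurable[OF f] Lip_c_zero[OF f]]
    by (auto simp: m_iff)
  moreover have "m' = m''" if m': "m' \<in> M1_plus A" "\<forall>f\<in>Lip_c A. has_rel_integral m' f (T f)"
    and m'': "m'' \<in> M1_plus A" "\<forall>f\<in>Lip_c A. has_rel_integral m'' f (T f)" for m' m''
  proof -
    \<comment> \<open>Equality of the classes follows once one representative of each agree on Borel
      sets off \<open>A\<close>.\<close>
    obtain \<mu> where \<mu>: "\<mu> \<in> borel_measures" "m' = rel_equiv A `` {\<mu>}"
      using m'(1) by (auto simp: M1_plus_def rel_borel_measures_def elim: quotientE)
    obtain \<nu> where \<nu>: "\<nu> \<in> borel_measures" "m'' = rel_equiv A `` {\<nu>}"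
      using m''(1) by (auto simp: M1_plus_def rel_borel_measures_def elim: quotientE)
    have mem: "\<mu> \<in> m'" "\<nu> \<in> m''"
      using \<mu> \<nu> equiv_class_self[OF eqv] by auto
    have "emeasure \<mu> E = emeasure \<nu> E" if "E \<in> sets borel" "E \<subseteq> - A" for E
      using representing_measure_unique[where \<mu> = \<mu> and \<nu> = \<nu> and T = T, OF _ _ _ _ _ that]
        mem m' m'' \<mu>(1) \<nu>(1)
      by (auto simp: M1_plus_def has_rel_integral_def borel_measures_def)
    then have "(\<mu>, \<nu>) \<in> rel_equiv A"
      using rel_equiv_iff[OF closed_A \<mu>(1) \<nu>(1)] by blast
    then show ?thesis unfolding \<mu>(2) \<nu>(2) by (rule equiv_class_eq[OF eqv])
  qed
  ultimately show ?thesis by blast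
qed

end
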